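(* Let $\phi:\mathbb{R}^n\to\mathbb{R}^n$ be a global $C^\infty$-diffeomorphism with $|J_\phi(x)|=|\det D\phi(x)|\neq 0$ for all $x$, and let $\omega\in C^\infty(\mathbb{R}^n;\mathbb{C})$ be nowhere vanishing. Then the weighted Fourier transform $\mathcal{F}_{\phi,\omega}$ (defined by its integral on $L^1_{\phi,\omega}(\mathbb{R}^n)\cap L^2_{\phi,\omega}(\mathbb{R}^n)$) extends to a unitary operator from $L^2_{\phi,\omega}(\mathbb{R}^n)$ onto $L^2(\mathbb{R}^n)$. Specifically, for all $f,g\in L^2_{\phi,\omega}(\mathbb{R}^n)$, $$\langle f,g\rangle_{\phi,\omega}=\langle\mathcal{F}_{\phi,\omega}f,\mathcal{F}_{\phi,\omega}g\rangle_{L^2(\mathbb{R}^n)},$$ and in particular $$\|f\|_{\phi,\omega}^2=\int_{\mathbb{R}^n}|f(x)|^2|\omega(x)|^2|J_\phi(x)|\,dx=\int_{\mathbb{R}^n}|[\mathcal{F}_{\phi,\omega}f](\xi)|^2\,d\xi .$$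
   Context: $L^2_{\phi,\omega}(\mathbb{R}^n)$ is the Hilbert space of measurable $f:\mathbb{R}^n\to\mathbb{C}$ with $\|f\|_{\phi,\omega}^2=\int_{\mathbb{R}^n}|f|^2|\omega|^2|J_\phi|\,dx<\infty$ and inner product $\langle f,g\rangle_{\phi,\omega}=\int_{\mathbb{R}^n}f\bar g\,|\omega|^2|J_\phi|\,dx$. $L^1_{\phi,\omega}(\mathbb{R}^n)$ is the space of measurable $f$ with $\int_{\mathbb{R}^n}|f||\omega||J_\phi|\,dx<\infty$. For $f\in L^1_{\phi,\omega}(\mathbb{R}^n)$ the weighted Fourier transform is $$[\mathcal{F}_{\phi,\omega}f](\xi)=\frac{1}{(2\pi)^{n/2}}\int_{\mathbb{R}^n}e^{-i\xi\cdot\phi(x)}\,\omega(x)f(x)\,|J_\phi(x)|\,dx .$$ *)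

theory Defs
  imports "HOL-Analysis.Analysis"
begin

text \<open>
  \<open>C_k_map k f\<close>: the map \<open>f\<close> is of class \<open>C^k\<close> on the whole space, in the sense of real
  (Frechet) differentiability.  The derivative is tracked through the maps
  \<open>x \<mapsto> Df(x) v\<close>, which have the same type as \<open>f\<close>; in finite dimensions they are \<open>C^k\<close>
  for all \<open>v\<close> iff \<open>Df\<close> is.
\<close>

primrec C_k_map ::
  "nat \<Rightarrow> ('a::euclidean_space \<Rightarrow> 'b::real_normed_vector) \<Rightarrow> bool" where
  "C_k_map 0 f \<longleftrightarrow> continuous_on UNIV f"
| "C_k_map (Suc k) f \<longleftrightarrow>
     (\<forall>x. f differentiable (at x)) \<and>
     (\<forall>v. C_k_map k (\<lambda>x. frechet_derivative f (at x) v))"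

definition smooth_map :: "('a::euclidean_space \<Rightarrow> 'b::real_normed_vector) \<Rightarrow> bool" where
  "smooth_map f \<longleftrightarrow> (\<forall>k. C_k_map k f)"

definition smooth_diffeo :: "('a::euclidean_space \<Rightarrow> 'a) \<Rightarrow> bool" where
  "smooth_diffeo \<phi> \<longleftrightarrow> bij \<phi> \<and> smooth_map \<phi> \<and> smooth_map (inv \<phi>)"

definition jacobian_det :: "(real ^ 'n \<Rightarrow> real ^ 'n) \<Rightarrow> real ^ 'n \<Rightarrow> real" where
  "jacobian_det \<phi> x = det (jacobian \<phi> (at x))"

text \<open>
  The spaces \<open>L^1(w dx)\<close> and \<open>L^2(w dx)\<close> for a weight \<open>w\<close>.  Elements are Lebesgue measurable
  functions, not classes: identification of functions that are equal almost everywhere is made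
  explicit where it matters.  The weights used below are continuous and strictly positive, so
  ``almost everywhere'' means the same for \<open>w dx\<close> and for Lebesgue measure.
\<close>

definition wL1 :: "('a::euclidean_space \<Rightarrow> real) \<Rightarrow> ('a \<Rightarrow> complex) set" where
  "wL1 w = {f \<in> borel_measurable lebesgue. integrable lebesgue (\<lambda>x. cmod (f x) * w x)}"

definition wL2 :: "('a::euclidean_space \<Rightarrow> real) \<Rightarrow> ('a \<Rightarrow> complex) set" where
  "wL2 w = {f \<in> borel_measurable lebesgue. integrable lebesgue (\<lambda>x. (cmod (f x))\<^sup>2 * w x)}"

definition wL2_inner ::
  "('a::euclidean_space \<Rightarrow> real) \<Rightarrow> ('a \<Rightarrow> complex) \<Rightarrow> ('a \<Rightarrow> complex) \<Rightarrow> complex" where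
  "wL2_inner w f g = (LINT x|lebesgue. f x * cnj (g x) * complex_of_real (w x))"

definition wL2_norm :: "('a::euclidean_space \<Rightarrow> real) \<Rightarrow> ('a \<Rightarrow> complex) \<Rightarrow> real" where
  "wL2_norm w f = sqrt (LINT x|lebesgue. (cmod (f x))\<^sup>2 * w x)"

text \<open>
  A map on representatives that induces a unitary operator from \<open>L^2(w dx)\<close> onto \<open>L^2(v dx)\<close>
  after passing to classes modulo equality almost everywhere.
\<close>

definition unitary_wL2 ::
  "('a::euclidean_space \<Rightarrow> real) \<Rightarrow> ('b::euclidean_space \<Rightarrow> real)
    \<Rightarrow> (('a \<Rightarrow> complex) \<Rightarrow> ('b \<Rightarrow> complex)) \<Rightarrow> bool" where
  "unitary_wL2 w v U \<longleftrightarrow>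
     (\<forall>f \<in> wL2 w. U f \<in> wL2 v) \<and>
     (\<forall>f \<in> wL2 w. \<forall>g \<in> wL2 w.
        (AE x in lebesgue. f x = g x) \<longrightarrow> (AE y in lebesgue. U f y = U g y)) \<and>
     (\<forall>f \<in> wL2 w. \<forall>g \<in> wL2 w. \<forall>a b.
        AE y in lebesgue. U (\<lambda>x. a * f x + b * g x) y = a * U f y + b * U g y) \<and>
     (\<forall>f \<in> wL2 w. \<forall>g \<in> wL2 w. wL2_inner v (U f) (U g) = wL2_inner w f g) \<and>
     (\<forall>h \<in> wL2 v. \<exists>f \<in> wL2 w. AE y in lebesgue. U f y = h y)"

definition L1_\<phi>\<omega> ::
  "(real ^ 'n \<Rightarrow> real ^ 'n) \<Rightarrow> (real ^ 'n \<Rightarrow> complex) \<Rightarrow> (real ^ 'n \<Rightarrow> complex) set" where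
  "L1_\<phi>\<omega> \<phi> \<omega> = wL1 (\<lambda>x. cmod (\<omega> x) * \<bar>jacobian_det \<phi> x\<bar>)"

definition weight2 ::
  "(real ^ 'n \<Rightarrow> real ^ 'n) \<Rightarrow> (real ^ 'n \<Rightarrow> complex) \<Rightarrow> real ^ 'n \<Rightarrow> real" where
  "weight2 \<phi> \<omega> x = (cmod (\<omega> x))\<^sup>2 * \<bar>jacobian_det \<phi> x\<bar>"

abbreviation L2_\<phi>\<omega> ::
  "(real ^ 'n \<Rightarrow> real ^ 'n) \<Rightarrow> (real ^ 'n \<Rightarrow> complex) \<Rightarrow> (real ^ 'n \<Rightarrow> complex) set" where
  "L2_\<phi>\<omega> \<phi> \<omega> \<equiv> wL2 (weight2 \<phi> \<omega>)"

definition weighted_fourier ::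
  "(real ^ 'n \<Rightarrow> real ^ 'n) \<Rightarrow> (real ^ 'n \<Rightarrow> complex) \<Rightarrow> (real ^ 'n \<Rightarrow> complex)
    \<Rightarrow> real ^ 'n \<Rightarrow> complex" where
  "weighted_fourier \<phi> \<omega> f \<xi> =
     complex_of_real (1 / (2 * pi) powr (real CARD('n) / 2)) *
     (LINT x|lebesgue. exp (- \<i> * complex_of_real (\<xi> \<bullet> \<phi> x)) * \<omega> x * f x
                          * complex_of_real \<bar>jacobian_det \<phi> x\<bar>)"

end

theory Submission
  imports Defs "HOL-Probability.Characteristic_Functions"
begin

text \<open>
  Substituting \<open>y = \<phi> x\<close> turns \<open>\<F>\<^bsub>\<phi>,\<omega>\<^esub> f\<close> into the ordinary Fourier transform of
  \<open>T f = (\<omega> f) \<circ> \<phi>\<^sup>-\<^sup>1\<close>, and \<open>T\<close> is unitary from the weighted space onto \<open>L\<^sup>2\<close>; the rest is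
  Plancherel's theorem.  For the latter, the multiplication formula \<open>\<integral> \<F>f g = \<integral> f \<F>g\<close> with a
  Gaussian regularisation shows that \<open>\<F>\<close> contracts the \<open>L\<^sup>2\<close> norm on \<open>L\<^sup>1 \<inter> L\<^sup>2\<close> and that
  \<open>\<integral> \<F>f \<F>g = \<integral> f(x) g(-x)\<close> for bounded continuous integrable \<open>g\<close>.  The contraction extends to
  \<open>L\<^sup>2\<close> by completeness, and testing against such \<open>g\<close> gives \<open>\<F>\<F>f = f(-x)\<close>.  A contraction
  whose square is isometric and onto is itself isometric and onto, so no density argument for
  continuous functions is needed.
\<close>

section \<open>Square-integrable functions\<close>

text \<open>A Gaussian average of autocorrelations bounds the norm of \<open>ft f\<close> from above
  at once, because shifted products are controlled by the unshifted square. Equality in that limit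
  would need continuity of the autocorrelation at shift 0, that is, of translations in L2; this is
  where density of continuous functions usually enters. The reverse inequality is obtained instead
  from the inversion formula: ||f|| = ||FFf|| \<le> ||Ff||. Pairings stay bilinear, without
  conjugates, because the kernel exp (-i xi.x) is symmetric in its two variables. Hence F is applied
  twice where an inverse transform might be expected, and the reflection x -> -x appears. Norms are
  squared and \<open>ennreal\<close>-valued, so that estimates can be stated before integrability is
  known; the price is a factor 2 in the triangle inequality. The analysis runs on Borel functions
  and \<open>lborel\<close>, where Fubini and composition are at hand; Lebesgue measurable functions
  enter only at the end, through Borel representatives.\<close>

definition l2sq :: "'a measure \<Rightarrow> ('a \<Rightarrow> complex) \<Rightarrow> ennreal" where
  "l2sq M f = (\<integral>\<^sup>+x. ennreal ((cmod (f x))\<^sup>2) \<partial>M)"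

definition L2sp :: "'a measure \<Rightarrow> ('a \<Rightarrow> complex) set" where
  "L2sp M = {f \<in> borel_measurable M. l2sq M f < \<infinity>}"

lemma L2sp_measurable: "f \<in> L2sp M \<Longrightarrow> f \<in> borel_measurable M"
  by (simp add: L2sp_def)

lemma L2sp_finite: "f \<in> L2sp M \<Longrightarrow> l2sq M f < \<infinity>"
  by (simp add: L2sp_def)

lemma l2sq_cong_AE: "AE x in M. f x = g x \<Longrightarrow> l2sq M f = l2sq M g"
  unfolding l2sq_def by (intro nn_integral_cong_AE) auto

lemma L2sp_iff_integrable:
  "f \<in> L2sp M \<longleftrightarrow> f \<in> borel_measurable M \<and> integrable M (\<lambda>x. (cmod (f x))\<^sup>2)"
  unfolding L2sp_def l2sq_def integrable_iff_bounded by auto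

lemma l2sq_eq_integral:
  assumes "f \<in> L2sp M"
  shows "l2sq M f = ennreal (\<integral>x. (cmod (f x))\<^sup>2 \<partial>M)"
  using assms unfolding L2sp_iff_integrable l2sq_def
  by (subst nn_integral_eq_integral) auto

lemma cmod_add_square_le: "(cmod (a + b))\<^sup>2 \<le> 2 * (cmod a)\<^sup>2 + 2 * (cmod b)\<^sup>2"
proof -
  have "(cmod (a + b))\<^sup>2 \<le> (cmod a + cmod b)\<^sup>2"
    by (intro power_mono norm_triangle_ineq) auto
  also have "\<dots> \<le> 2 * (cmod a)\<^sup>2 + 2 * (cmod b)\<^sup>2"
    using sum_squares_bound[of "cmod a" "cmod b"] by (simp add: power2_sum)
  finally show ?thesis .
qed

text \<open>The constant 2 comes from (s + t)^2 \<le> 2 s^2 + 2 t^2 and spares the square roots of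
  Minkowski's inequality. It only serves finiteness and limits equal to 0, where constants do not
  matter.\<close>

lemma l2sq_add_le:
  assumes [measurable]: "f \<in> borel_measurable M" "g \<in> borel_measurable M"
  shows "l2sq M (\<lambda>x. f x + g x) \<le> 2 * l2sq M f + 2 * l2sq M g"
proof -
  have "l2sq M (\<lambda>x. f x + g x)
      \<le> (\<integral>\<^sup>+x. 2 * ennreal ((cmod (f x))\<^sup>2) + 2 * ennreal ((cmod (g x))\<^sup>2) \<partial>M)"
    unfolding l2sq_def
  proof (intro nn_integral_mono)
    fix x
    have "ennreal ((cmod (f x + g x))\<^sup>2) \<le> ennreal (2 * (cmod (f x))\<^sup>2 + 2 * (cmod (g x))\<^sup>2)"
      by (intro ennreal_leI cmod_add_square_le)
    then show "ennreal ((cmod (f x + g x))\<^sup>2)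
        \<le> 2 * ennreal ((cmod (f x))\<^sup>2) + 2 * ennreal ((cmod (g x))\<^sup>2)"
      by (simp add: ennreal_plus ennreal_mult)
  qed
  also have "\<dots> = 2 * l2sq M f + 2 * l2sq M g"
    unfolding l2sq_def by (simp add: nn_integral_add nn_integral_cmult)
  finally show ?thesis .
qed

lemma l2sq_cmult:
  assumes [measurable]: "f \<in> borel_measurable M"
  shows "l2sq M (\<lambda>x. c * f x) = ennreal ((cmod c)\<^sup>2) * l2sq M f"
  unfolding l2sq_def
  by (simp add: norm_mult power_mult_distrib ennreal_mult nn_integral_cmult)

lemma L2sp_add:
  assumes "f \<in> L2sp M" "g \<in> L2sp M"
  shows "(\<lambda>x. f x + g x) \<in> L2sp M"
proof -
  have [measurable]: "f \<in> borel_measurable M" "g \<in> borel_measurable M"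
    using assms by (auto simp: L2sp_def)
  have "2 * l2sq M f + 2 * l2sq M g < \<infinity>"
    using assms by (simp add: L2sp_def ennreal_mult_less_top)
  then have "l2sq M (\<lambda>x. f x + g x) < \<infinity>"
    by (intro le_less_trans[OF l2sq_add_le]) auto
  then show ?thesis by (simp add: L2sp_def)
qed

lemma L2sp_cmult: "f \<in> L2sp M \<Longrightarrow> (\<lambda>x. c * f x) \<in> L2sp M"
  by (auto simp: L2sp_def l2sq_cmult ennreal_mult_less_top)

lemma L2sp_diff: "f \<in> L2sp M \<Longrightarrow> g \<in> L2sp M \<Longrightarrow> (\<lambda>x. f x - g x) \<in> L2sp M"
  using L2sp_add[of f M "\<lambda>x. (-1) * g x"] L2sp_cmult[of g M "-1"] by simp

lemma borel_measurable_cnj [measurable (raw)]: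
  "f \<in> borel_measurable M \<Longrightarrow> (\<lambda>x. cnj (f x)) \<in> borel_measurable M"
  by (rule measurable_compose[OF _ borel_measurable_continuous_onI[OF continuous_on_cnj[OF continuous_on_id]]])

lemma L2sp_cnj: "f \<in> L2sp M \<Longrightarrow> (\<lambda>x. cnj (f x)) \<in> L2sp M"
  by (simp add: L2sp_def l2sq_def borel_measurable_cnj)

lemma l2sq_cnj: "l2sq M (\<lambda>x. cnj (f x)) = l2sq M f"
  by (simp add: l2sq_def)

lemma l2sq_minus_commute: "l2sq M (\<lambda>x. f x - g x) = l2sq M (\<lambda>x. g x - f x)"
  by (simp add: l2sq_def norm_minus_commute)

lemma l2sq_triangle:
  assumes "f \<in> borel_measurable M" "g \<in> borel_measurable M" "h \<in> borel_measurable M"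
  shows "l2sq M (\<lambda>x. f x - h x) \<le> 2 * l2sq M (\<lambda>x. f x - g x) + 2 * l2sq M (\<lambda>x. g x - h x)"
  using l2sq_add_le[of "\<lambda>x. f x - g x" M "\<lambda>x. g x - h x"] assms by simp

lemma l2sq_eq_0_iff:
  assumes [measurable]: "f \<in> borel_measurable M"
  shows "l2sq M f = 0 \<longleftrightarrow> (AE x in M. f x = 0)"
  unfolding l2sq_def by (subst nn_integral_0_iff_AE) auto

lemma integrable_L2sp_mult:
  assumes f: "f \<in> L2sp M" and g: "g \<in> L2sp M"
  shows "integrable M (\<lambda>x. f x * g x)"
proof (rule Bochner_Integration.integrable_bound)
  show "integrable M (\<lambda>x. (cmod (f x))\<^sup>2 + (cmod (g x))\<^sup>2)"
    using f g by (auto simp: L2sp_iff_integrable)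
  show "(\<lambda>x. f x * g x) \<in> borel_measurable M"
    using f g by (auto simp: L2sp_def)
  have "cmod (f x) * cmod (g x) \<le> (cmod (f x))\<^sup>2 + (cmod (g x))\<^sup>2" for x
    using sum_squares_bound[of "cmod (f x)" "cmod (g x)"]
      mult_nonneg_nonneg[of "cmod (f x)" "cmod (g x)"] by (simp del: zero_le_mult_iff mult_nonneg_nonneg)
  then show "AE x in M. norm (f x * g x) \<le> norm ((cmod (f x))\<^sup>2 + (cmod (g x))\<^sup>2)"
    by (simp add: norm_mult)
qed

text \<open>There is no conjugate on \<open>g\<close>, to match the bilinear multiplication formula;
  moduli do not see the difference.\<close>

lemma Cauchy_Schwarz_L2sp:
  assumes f: "f \<in> L2sp M" and g: "g \<in> L2sp M"
  shows "ennreal ((cmod (\<integral>x. f x * g x \<partial>M))\<^sup>2) \<le> l2sq M f * l2sq M g"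
proof -
  have [measurable]: "f \<in> borel_measurable M" "g \<in> borel_measurable M"
    using f g by (auto simp: L2sp_def)
  have "ennreal (cmod (\<integral>x. f x * g x \<partial>M)) \<le> (\<integral>\<^sup>+x. ennreal (cmod (f x * g x)) \<partial>M)"
    using integral_norm_bound_ennreal[OF integrable_L2sp_mult[OF f g]] .
  also have "\<dots> = (\<integral>\<^sup>+x. ennreal (cmod (f x)) * ennreal (cmod (g x)) \<partial>M)"
    by (simp add: norm_mult ennreal_mult)
  finally have "(ennreal (cmod (\<integral>x. f x * g x \<partial>M)))\<^sup>2
      \<le> (\<integral>\<^sup>+x. ennreal (cmod (f x)) * ennreal (cmod (g x)) \<partial>M)\<^sup>2"
    by (intro power_mono) auto
  also have "\<dots> \<le> (\<integral>\<^sup>+x. (ennreal (cmod (f x)))\<^sup>2 \<partial>M) * (\<integral>\<^sup>+x. (ennreal (cmod (g x)))\<^sup>2 \<partial>M)"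
    by (intro Cauchy_Schwarz_nn_integral) auto
  finally show ?thesis
    by (simp add: l2sq_def ennreal_power)
qed

text \<open>The device for passing from truncations to general L2 functions: Cauchy-Schwarz applied
  to the difference makes pairings with a fixed L2 function continuous.\<close>

lemma tendsto_integral_mult_L2sp:
  assumes u: "\<And>k. u k \<in> L2sp M" "v \<in> L2sp M" "w \<in> L2sp M"
    and lim: "(\<lambda>k. l2sq M (\<lambda>x. u k x - v x)) \<longlonglongrightarrow> 0"
  shows "(\<lambda>k. \<integral>x. u k x * w x \<partial>M) \<longlonglongrightarrow> (\<integral>x. v x * w x \<partial>M)"
proof -
  let ?d = "\<lambda>k. (\<integral>x. u k x * w x \<partial>M) - (\<integral>x. v x * w x \<partial>M)"
  have "?d k = (\<integral>x. (u k x - v x) * w x \<partial>M)" for k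
    unfolding left_diff_distrib
    by (intro Bochner_Integration.integral_diff[symmetric] integrable_L2sp_mult u)
  then have bd: "ennreal ((cmod (?d k))\<^sup>2) \<le> l2sq M (\<lambda>x. u k x - v x) * l2sq M w" for k
    using Cauchy_Schwarz_L2sp[OF L2sp_diff[OF u(1) u(2)] u(3)] by simp
  have "(\<lambda>k. l2sq M (\<lambda>x. u k x - v x) * l2sq M w) \<longlonglongrightarrow> 0 * l2sq M w"
    using L2sp_finite[OF u(3)] by (intro tendsto_mult_ennreal lim tendsto_const) auto
  then have lim0: "(\<lambda>k. l2sq M (\<lambda>x. u k x - v x) * l2sq M w) \<longlonglongrightarrow> 0"
    by simp
  have "(\<lambda>k. ennreal ((cmod (?d k))\<^sup>2)) \<longlonglongrightarrow> 0"
    by (rule tendsto_sandwich[OF _ _ tendsto_const lim0]) (use bd in simp_all)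
  then have "(\<lambda>k. (cmod (?d k))\<^sup>2) \<longlonglongrightarrow> 0"
    by (subst (asm) ennreal_tendsto_0_iff) auto
  then have "(\<lambda>k. sqrt ((cmod (?d k))\<^sup>2)) \<longlonglongrightarrow> sqrt 0"
    by (intro tendsto_real_sqrt)
  then have "(\<lambda>k. cmod (?d k)) \<longlonglongrightarrow> 0"
    by simp
  then have "?d \<longlonglongrightarrow> 0"
    by (rule tendsto_norm_zero_cancel)
  then show ?thesis
    by (rule LIM_zero_cancel)
qed

lemma L2sp_limit_unique:
  assumes [measurable]: "\<And>k. u k \<in> borel_measurable M" "g \<in> borel_measurable M" "h \<in> borel_measurable M"
    and g: "(\<lambda>k. l2sq M (\<lambda>x. u k x - g x)) \<longlonglongrightarrow> 0"
    and h: "(\<lambda>k. l2sq M (\<lambda>x. u k x - h x)) \<longlonglongrightarrow> 0"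
  shows "AE x in M. g x = h x"
proof -
  have "l2sq M (\<lambda>x. g x - h x) \<le> 2 * l2sq M (\<lambda>x. u k x - g x) + 2 * l2sq M (\<lambda>x. u k x - h x)" for k
    using l2sq_triangle[of g M "u k" h] by (simp add: l2sq_minus_commute[of M g])
  moreover have "(\<lambda>k. 2 * l2sq M (\<lambda>x. u k x - g x) + 2 * l2sq M (\<lambda>x. u k x - h x))
      \<longlonglongrightarrow> 2 * 0 + 2 * 0"
    by (intro tendsto_add tendsto_mult_ennreal tendsto_const g h) auto
  ultimately have "l2sq M (\<lambda>x. g x - h x) \<le> 0"
    by (intro LIMSEQ_le_const) auto
  then have "AE x in M. g x - h x = 0"
    by (simp add: l2sq_eq_0_iff)
  then show ?thesis by simp
qed

text \<open>
  Along a subsequence with \<open>\<parallel>u\<^sub>k\<^sub>+\<^sub>1 - u\<^sub>k\<parallel>\<^sup>2 \<le> 4\<^sup>-\<^sup>k\<close> the sum of \<open>2\<^sup>k |u\<^sub>k\<^sub>+\<^sub>1 - u\<^sub>k|\<^sup>2\<close> has finite integral, which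
  gives pointwise convergence almost everywhere without Minkowski's inequality.
\<close>

theorem L2sp_complete:
  assumes u: "\<And>k. u k \<in> L2sp M"
    and Cauchy: "\<And>e. 0 < e \<Longrightarrow> \<exists>N. \<forall>m\<ge>N. \<forall>n\<ge>N. l2sq M (\<lambda>x. u m x - u n x) \<le> ennreal e"
  shows "\<exists>g \<in> L2sp M. (\<lambda>k. l2sq M (\<lambda>x. u k x - g x)) \<longlonglongrightarrow> 0"
proof -
  have [measurable]: "u k \<in> borel_measurable M" for k
    using u by (simp add: L2sp_def)
  have "\<forall>k::nat. \<exists>N. \<forall>m\<ge>N. \<forall>n\<ge>N. l2sq M (\<lambda>x. u m x - u n x) \<le> ennreal ((1/4) ^ k)"
    by (intro allI Cauchy) simp
  from choice[OF this] obtain N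
    where "\<forall>k::nat. \<forall>m\<ge>N k. \<forall>n\<ge>N k. l2sq M (\<lambda>x. u m x - u n x) \<le> ennreal ((1/4) ^ k)"
    by auto
  then have N: "\<And>k m n. N k \<le> m \<Longrightarrow> N k \<le> n \<Longrightarrow>
      l2sq M (\<lambda>x. u m x - u n x) \<le> ennreal ((1/4) ^ k)" by simp
  \<comment> \<open>The sum puts \<open>r m\<close> beyond \<open>N k\<close> for every k \<le> m,
    so \<open>r k\<close> and \<open>r (Suc k)\<close> both lie beyond \<open>N k\<close>; the
    summand \<open>k\<close> makes the indices tend to infinity.\<close>
  define r where "r k = k + (\<Sum>i\<le>k. N i)" for k
  have rN: "N k \<le> r m" if "k \<le> m" for k m
    proof -
    have "N k \<le> (\<Sum>i\<le>m. N i)" using that by (intro member_le_sum) auto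
    then show ?thesis by (simp add: r_def)
  qed
  have r_ge: "k \<le> r k" for k
    by (simp add: r_def)
  define d where "d k x = (cmod (u (r (Suc k)) x - u (r k) x))\<^sup>2" for k x
  have [measurable]: "d k \<in> borel_measurable M" for k
    unfolding d_def by measurable
  have dint: "(\<integral>\<^sup>+x. ennreal (d k x) \<partial>M) \<le> ennreal ((1/4) ^ k)" for k
    using N[of k "r (Suc k)" "r k"] rN[of k k] rN[of k "Suc k"] unfolding d_def l2sq_def by simp
  have "(\<integral>\<^sup>+x. (\<Sum>k. ennreal (2 ^ k * d k x)) \<partial>M) = (\<Sum>k. \<integral>\<^sup>+x. ennreal (2 ^ k * d k x) \<partial>M)"
    by (rule nn_integral_suminf) measurable
  also have "\<dots> \<le> (\<Sum>k. ennreal ((1/2) ^ k))"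
  proof (intro suminf_le summableI)
    fix k
    have "(\<integral>\<^sup>+x. ennreal (2 ^ k * d k x) \<partial>M) = ennreal (2 ^ k) * (\<integral>\<^sup>+x. ennreal (d k x) \<partial>M)"
      by (simp add: ennreal_mult' nn_integral_cmult)
    also have "\<dots> \<le> ennreal (2 ^ k) * ennreal ((1/4) ^ k)"
      by (intro mult_left_mono dint) auto
    also have "\<dots> = ennreal ((1/2) ^ k)"
      by (simp add: ennreal_mult'[symmetric] power_mult_distrib[symmetric])
    finally show "(\<integral>\<^sup>+x. ennreal (2 ^ k * d k x) \<partial>M) \<le> ennreal ((1/2) ^ k)" .
  qed
  also have "\<dots> < \<infinity>"
    by (subst suminf_ennreal2) (auto simp: summable_geometric)
  finally have "AE x in M. (\<Sum>k. ennreal (2 ^ k * d k x)) \<noteq> \<infinity>"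
    by (intro nn_integral_PInf_AE) auto
  then have conv: "AE x in M. convergent (\<lambda>k. u (r k) x)"
  proof eventually_elim
    case (elim x)
    have nn: "0 \<le> 2 ^ k * d k x" for k by (simp add: d_def)
    have "summable (\<lambda>k. 2 ^ k * d k x)"
      using elim nn by (intro summable_suminf_not_top) auto
    \<comment> \<open>Only boundedness of the terms is taken from the series: |u_(k+1) - u_k|^2
      \<le> C 2^(-k) along the subsequence, so the increments are dominated by a geometric series of
      ratio \<open>sqrt (1/2)\<close>.\<close>
    then have "Bseq (\<lambda>k. 2 ^ k * d k x)"
      by (intro convergent_imp_Bseq convergentI[OF summable_LIMSEQ_zero])
    then obtain C where C: "C > 0" "\<And>k. 2 ^ k * d k x \<le> C"
      unfolding Bseq_def using nn by (auto simp: d_def)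
    have bound: "norm (u (r (Suc k)) x - u (r k) x) \<le> sqrt C * (sqrt (1/2)) ^ k" for k
    proof -
      have "d k x \<le> C * (1/2) ^ k"
        using C(2)[of k] by (simp add: field_simps power_divide)
      then have "sqrt (d k x) \<le> sqrt (C * (1/2) ^ k)" by simp
      then show ?thesis by (simp add: d_def real_sqrt_mult real_sqrt_power)
    qed
    have "summable (\<lambda>k. sqrt C * (sqrt (1/2)) ^ k)"
      by (intro summable_mult summable_geometric) (simp add: real_sqrt_divide)
    then have "summable (\<lambda>k. u (r (Suc k)) x - u (r k) x)"
      by (rule summable_comparison_test'[where N=0]) (use bound in auto)
    then have "convergent (\<lambda>m. u (r m) x - u (r 0) x)"
      using sum_lessThan_telescope[of "\<lambda>k. u (r k) x"] by (simp add: summable_iff_convergent)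
    then have "convergent (\<lambda>m. (u (r m) x - u (r 0) x) + u (r 0) x)"
      by (intro convergent_add convergent_const)
    then show "convergent (\<lambda>k. u (r k) x)" by simp
  qed
  define g where "g x = lim (\<lambda>k. u (r k) x)" for x
  have [measurable]: "g \<in> borel_measurable M"
    unfolding g_def by measurable
  have lim: "AE x in M. (\<lambda>k. u (r k) x) \<longlonglongrightarrow> g x"
    using conv by eventually_elim (auto simp: g_def convergent_LIMSEQ_iff)
  \<comment> \<open>Fatou's lemma in the second index: \<open>n\<close> is fixed and
    \<open>u (r k)\<close> tends to \<open>g\<close> almost everywhere, so a Cauchy bound beyond
    \<open>K\<close> survives with \<open>g\<close> in place of the second function. It yields both
    the convergence and the membership of \<open>g\<close>.\<close>
  have small: "l2sq M (\<lambda>x. u n x - g x) \<le> ennreal e"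
    if NN: "\<forall>m\<ge>K. \<forall>n\<ge>K. l2sq M (\<lambda>x. u m x - u n x) \<le> ennreal e" and n: "n \<ge> K" for e K n
  proof -
    have "l2sq M (\<lambda>x. u n x - g x)
        = (\<integral>\<^sup>+x. liminf (\<lambda>k. ennreal ((cmod (u n x - u (r k) x))\<^sup>2)) \<partial>M)"
      unfolding l2sq_def
    proof (rule nn_integral_cong_AE, use lim in eventually_elim)
      case (elim x)
      have "(\<lambda>k. ennreal ((cmod (u n x - u (r k) x))\<^sup>2)) \<longlonglongrightarrow> ennreal ((cmod (u n x - g x))\<^sup>2)"
        by (intro tendsto_intros elim)
      from lim_imp_Liminf[OF sequentially_bot this] show ?case by simp
    qed
    also have "\<dots> \<le> liminf (\<lambda>k. l2sq M (\<lambda>x. u n x - u (r k) x))"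
      unfolding l2sq_def by (intro nn_integral_liminf) measurable
    also have "\<dots> \<le> limsup (\<lambda>k. l2sq M (\<lambda>x. u n x - u (r k) x))"
      by (intro Liminf_le_Limsup) auto
    also have "\<dots> \<le> ennreal e"
    proof (intro Limsup_bounded eventually_sequentiallyI[of K])
      fix k assume "K \<le> k"
      then have "K \<le> r k" using r_ge[of k] by simp
      then show "l2sq M (\<lambda>x. u n x - u (r k) x) \<le> ennreal e" using NN n by blast
    qed
    finally show ?thesis .
  qed
  have "(\<lambda>k. l2sq M (\<lambda>x. u k x - g x)) \<longlonglongrightarrow> 0"
  proof (rule order_tendstoI)
    fix a :: ennreal assume "0 < a"
    \<comment> \<open>For infinite \<open>a\<close> any positive \<open>e\<close> will do. Below,
      \<open>e / 2\<close> turns a weak bound into a strict one.\<close>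
    then obtain e where e: "0 < e" "ennreal e \<le> a"
      by (cases a) (auto intro: that[of 1] simp: ennreal_zero_less_top)
    from \<open>0 < e\<close>
    obtain K where "\<forall>m\<ge>K. \<forall>n\<ge>K. l2sq M (\<lambda>x. u m x - u n x) \<le> ennreal (e / 2)"
      using Cauchy[of "e / 2"] by auto
    then have "l2sq M (\<lambda>x. u n x - g x) \<le> ennreal (e / 2)" if "n \<ge> K" for n
      using small that by blast
    moreover have "ennreal (e / 2) < ennreal e"
      using \<open>0 < e\<close> by (simp add: ennreal_less_iff)
    ultimately have "l2sq M (\<lambda>x. u n x - g x) < a" if "n \<ge> K" for n
      using that e(2) by (meson order.strict_trans1 order.strict_trans2)
    then show "\<forall>\<^sub>F n in sequentially. l2sq M (\<lambda>x. u n x - g x) < a"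
      by (intro eventually_sequentiallyI[of K])
  qed simp
  moreover have "g \<in> L2sp M"
  proof -
    obtain K where "\<forall>m\<ge>K. \<forall>n\<ge>K. l2sq M (\<lambda>x. u m x - u n x) \<le> ennreal 1"
      using Cauchy[of 1] by auto
    then have "l2sq M (\<lambda>x. u K x - g x) \<le> ennreal 1"
      using small by blast
    then have "(\<lambda>x. u K x - g x) \<in> L2sp M"
      by (auto simp: L2sp_def intro: le_less_trans)
    from L2sp_diff[OF u[of K] this] show ?thesis by simp
  qed
  ultimately show ?thesis by auto
qed

section \<open>Gaussians and the Fourier transform of integrable functions\<close>

text \<open>Lebesgue measure is the image of a product of one-dimensional ones under the map from
  coordinates to vectors (\<open>lborel_eq\<close>). The factor may vary with the basis vector
  because exp (-i xi.x) splits into factors of different frequencies.\<close>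

lemma lborel_integral_prod:
  fixes f :: "'a::euclidean_space \<Rightarrow> real \<Rightarrow> 'b::{real_normed_field, banach, second_countable_topology}"
  assumes f: "\<And>b. b \<in> Basis \<Longrightarrow> integrable lborel (f b)"
  shows "integrable lborel (\<lambda>x::'a. \<Prod>b\<in>Basis. f b (x \<bullet> b))"
    and "(\<integral>x. (\<Prod>b\<in>Basis. f b ((x::'a) \<bullet> b)) \<partial>lborel) = (\<Prod>b\<in>Basis. \<integral>t. f b t \<partial>lborel)"
proof -
  interpret P: product_sigma_finite "\<lambda>_::'a. lborel :: real measure" ..
  let ?T = "\<lambda>g. \<Sum>b\<in>Basis. g b *\<^sub>R (b::'a)"
  let ?P = "\<Pi>\<^sub>M b\<in>(Basis::'a set). lborel :: real measure"
  have T: "?T \<in> measurable ?P borel"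
    by measurable
  have [measurable]: "b \<in> Basis \<Longrightarrow> f b \<in> borel_measurable borel" for b
    using borel_measurable_integrable[OF f] by simp
  have F: "(\<lambda>x::'a. \<Prod>b\<in>Basis. f b (x \<bullet> b)) \<in> borel_measurable borel"
    by measurable
  have eq: "(\<Prod>b\<in>Basis. f b (?T g \<bullet> b)) = (\<Prod>b\<in>Basis. f b (g b))" for g
    by (intro prod.cong refl) (simp add: inner_sum_left_Basis)
  show "integrable lborel (\<lambda>x::'a. \<Prod>b\<in>Basis. f b (x \<bullet> b))"
    using P.product_integrable_prod[of Basis f] f
    by (subst lborel_eq, subst integrable_distr_eq[OF T F]) (simp add: eq)
  show "(\<integral>x. (\<Prod>b\<in>Basis. f b ((x::'a) \<bullet> b)) \<partial>lborel) = (\<Prod>b\<in>Basis. \<integral>t. f b t \<partial>lborel)"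
    using P.product_integral_prod[of Basis f] f
    by (subst lborel_eq, subst integral_distr[OF T F]) (simp add: eq)
qed

lemma lborel_integral_affine:
  fixes f :: "'a::euclidean_space \<Rightarrow> 'b::{banach, second_countable_topology}"
  assumes [measurable]: "f \<in> borel_measurable borel" and c: "c \<noteq> 0"
  shows "(\<integral>x. f x \<partial>lborel) = (\<bar>c\<bar> ^ DIM('a)) *\<^sub>R (\<integral>x. f (t + c *\<^sub>R x) \<partial>lborel)"
proof -
  have "(\<integral>x. f x \<partial>lborel)
      = (\<integral>x. f x \<partial>density (distr lborel borel (\<lambda>x. t + c *\<^sub>R x)) (\<lambda>_. ennreal (\<bar>c\<bar> ^ DIM('a))))"
    using lborel_affine[OF c, of t] by (simp add: ennreal_power)
  also have "\<dots> = (\<bar>c\<bar> ^ DIM('a)) *\<^sub>R (\<integral>x. f (t + c *\<^sub>R x) \<partial>lborel)"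
    by (simp add: integral_density integral_distr)
  finally show ?thesis .
qed

lemma lborel_integrable_affine:
  fixes f :: "'a::euclidean_space \<Rightarrow> 'b::{banach, second_countable_topology}"
  assumes f: "integrable lborel f" and c: "c \<noteq> 0"
  shows "integrable lborel (\<lambda>x. f (t + c *\<^sub>R x))"
proof -
  have [measurable]: "f \<in> borel_measurable borel"
    using borel_measurable_integrable[OF f] by simp
  have "integrable (density (distr lborel borel (\<lambda>x. t + c *\<^sub>R x)) (\<lambda>_. ennreal (\<bar>c\<bar> ^ DIM('a)))) f"
    using f lborel_affine[OF c, of t] by (simp add: ennreal_power)
  then have "integrable lborel (\<lambda>x. (\<bar>c\<bar> ^ DIM('a)) *\<^sub>R f (t + c *\<^sub>R x))"
    by (simp add: integrable_density integrable_distr_eq)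
  from integrable_scaleR_right[OF this, of "1 / \<bar>c\<bar> ^ DIM('a)"] show ?thesis
    using c by simp
qed

lemma nn_integral_lborel_affine:
  fixes f :: "'a::euclidean_space \<Rightarrow> ennreal"
  assumes [measurable]: "f \<in> borel_measurable borel" and c: "c = 1 \<or> c = -1"
  shows "(\<integral>\<^sup>+x. f (t + c *\<^sub>R x) \<partial>lborel) = (\<integral>\<^sup>+x. f x \<partial>lborel)"
proof -
  have "c \<noteq> 0" "\<bar>c\<bar> = 1" using c by auto
  then have "lborel = distr lborel borel (\<lambda>x::'a. t + c *\<^sub>R x)"
    using lborel_affine[of c t] by (simp add: density_1)
  then have "(\<integral>\<^sup>+x. f x \<partial>lborel) = (\<integral>\<^sup>+x. f x \<partial>distr lborel borel (\<lambda>x::'a. t + c *\<^sub>R x))"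
    by simp
  also have "\<dots> = (\<integral>\<^sup>+x. f (t + c *\<^sub>R x) \<partial>lborel)"
    by (simp add: nn_integral_distr)
  finally show ?thesis ..
qed

text \<open>In this normalisation the Gaussian is its own transform under \<open>ft\<close>
  (\<open>integral_exp_gauss\<close>).\<close>

definition gauss :: "'a::euclidean_space \<Rightarrow> real" where
  "gauss x = exp (- (norm x)\<^sup>2 / 2)"

definition ft_const :: "'a::euclidean_space itself \<Rightarrow> real" where
  "ft_const _ = 1 / (2 * pi) powr (real DIM('a) / 2)"

text \<open>A total function: where the integrand is not integrable, the Bochner integral and hence
  \<open>ft f\<close> is 0.\<close>

definition ft :: "('a::euclidean_space \<Rightarrow> complex) \<Rightarrow> 'a \<Rightarrow> complex" where
  "ft f \<xi> = complex_of_real (ft_const TYPE('a)) *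
     (\<integral>x. exp (- \<i> * complex_of_real (\<xi> \<bullet> x)) * f x \<partial>lborel)"

lemma ft_const_pos: "ft_const TYPE('a::euclidean_space) > 0"
  by (simp add: ft_const_def)

lemma gauss_pos: "gauss x > 0"
  by (simp add: gauss_def)

lemma gauss_le_1: "gauss x \<le> 1"
  by (simp add: gauss_def)

lemma borel_measurable_gauss [measurable]: "gauss \<in> borel_measurable borel"
  unfolding gauss_def by measurable

lemma continuous_on_gauss: "continuous_on S (\<lambda>x. gauss (c *\<^sub>R x))"
  unfolding gauss_def by (intro continuous_intros) auto

lemma norm_exp_iinner [simp]: "cmod (exp (- (\<i> * complex_of_real t))) = 1"
  by (simp add: norm_exp_eq_Re)

lemma gauss_prod: "gauss (x::'a::euclidean_space) = (\<Prod>b\<in>Basis. exp (- (x \<bullet> b)\<^sup>2 / 2))"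
proof -
  have "(norm x)\<^sup>2 = (\<Sum>b\<in>Basis. (x \<bullet> b)\<^sup>2)"
    unfolding power2_norm_eq_inner euclidean_inner[of x x] by (simp add: power2_eq_square)
  then show ?thesis
    by (simp add: gauss_def exp_sum[symmetric] sum_negf sum_divide_distrib)
qed

lemma integrable_exp_square: "integrable lborel (\<lambda>t::real. exp (- t\<^sup>2 / 2))"
proof -
  have "integrable lborel (\<lambda>t. sqrt (2 * pi) * std_normal_density t)"
    by (intro integrable_mult_right integrable_normal_density) simp
  moreover have "sqrt (2 * pi) * std_normal_density t = exp (- t\<^sup>2 / 2)" for t
    using pi_gt_zero by (simp add: std_normal_density_def)
  ultimately show ?thesis by simp
qed

text \<open>This is the characteristic function of the standard normal distribution at -a, with the
  density's factor 1 / sqrt (2 pi) moved to the other side.\<close>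

lemma integral_iexp_square:
  "(\<integral>t. exp (- \<i> * complex_of_real (a * t)) * complex_of_real (exp (- t\<^sup>2 / 2)) \<partial>lborel)
     = complex_of_real (sqrt (2 * pi) * exp (- a\<^sup>2 / 2))"
proof -
  have "complex_of_real (exp (- a\<^sup>2 / 2)) = char std_normal_distribution (- a)"
    by (simp add: char_std_normal_distribution)
  also have "\<dots> = (\<integral>t. std_normal_density t *\<^sub>R iexp (- a * t) \<partial>lborel)"
    unfolding char_def by (subst integral_density) (auto simp: normal_density_nonneg)
  also have "\<dots> = (\<integral>t. complex_of_real (1 / sqrt (2 * pi)) *
      (exp (- \<i> * complex_of_real (a * t)) * complex_of_real (exp (- t\<^sup>2 / 2))) \<partial>lborel)"
    by (intro Bochner_Integration.integral_cong) (auto simp: std_normal_density_def scaleR_conv_of_real)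
  also have "\<dots> = complex_of_real (1 / sqrt (2 * pi)) *
      (\<integral>t. exp (- \<i> * complex_of_real (a * t)) * complex_of_real (exp (- t\<^sup>2 / 2)) \<partial>lborel)"
    by (rule integral_mult_right_zero)
  finally show ?thesis
    by (simp add: field_simps flip: of_real_mult)
qed

lemma integrable_gauss: "integrable lborel (gauss :: 'a::euclidean_space \<Rightarrow> real)"
  unfolding gauss_prod[abs_def] by (intro lborel_integral_prod(1) integrable_exp_square)

text \<open>Both the Gaussian and the character are products over the coordinates, so the
  one-dimensional formula applies factor by factor; \<open>ft_const\<close> cancels the resulting
  power of \<open>sqrt (2 * pi)\<close>.\<close>

lemma integral_exp_gauss:
  "complex_of_real (ft_const TYPE('a)) *
   (\<integral>x. exp (- \<i> * complex_of_real (\<xi> \<bullet> x)) * complex_of_real (gauss x) \<partial>lborel)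
     = complex_of_real (gauss (\<xi>::'a::euclidean_space))"
proof -
  let ?f = "\<lambda>b t. exp (- \<i> * complex_of_real ((\<xi> \<bullet> b) * t)) * complex_of_real (exp (- t\<^sup>2 / 2))"
  have int: "integrable lborel (?f b)" for b
    by (rule Bochner_Integration.integrable_bound[OF integrable_exp_square]) (auto simp: norm_mult)
  have eq: "exp (- \<i> * complex_of_real (\<xi> \<bullet> x)) * complex_of_real (gauss x)
      = (\<Prod>b\<in>Basis. ?f b (x \<bullet> b))" for x
    unfolding euclidean_inner[of \<xi> x] gauss_prod[of x]
    by (simp only: prod.distrib of_real_prod) (simp add: exp_sum[symmetric] sum_negf sum_distrib_left)
  have "(\<integral>x. exp (- \<i> * complex_of_real (\<xi> \<bullet> x)) * complex_of_real (gauss x) \<partial>lborel)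
      = (\<Prod>b\<in>Basis. complex_of_real (sqrt (2 * pi) * exp (- (\<xi> \<bullet> b)\<^sup>2 / 2)))"
    unfolding eq by (subst lborel_integral_prod(2)[OF int]) (simp only: integral_iexp_square)
  also have "\<dots> = complex_of_real (sqrt (2 * pi) ^ DIM('a) * gauss \<xi>)"
    by (simp add: gauss_prod prod.distrib)
  also have "sqrt (2 * pi) ^ DIM('a) = (2 * pi) powr (real DIM('a) / 2)"
    by (simp add: powr_half_sqrt[symmetric] powr_realpow[symmetric] powr_powr)
  finally show ?thesis
    by (simp add: ft_const_def)
qed

text \<open>The previous formula at frequency 0. It makes \<open>ft_const\<close> times
  \<open>gauss\<close> a probability density, so that the Gaussian integrals below are
  averages.\<close>

lemma integral_gauss: "ft_const TYPE('a) * (\<integral>x. gauss (x::'a::euclidean_space) \<partial>lborel) = 1"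
proof -
  have "complex_of_real (ft_const TYPE('a) * (\<integral>x. gauss (x::'a) \<partial>lborel)) = 1"
    using integral_exp_gauss[of "0::'a"] by (simp add: gauss_def)
  then show ?thesis
    by (simp only: of_real_eq_1_iff)
qed

section \<open>Elementary properties of the Fourier integral and the multiplication formula\<close>

lemma borel_measurable_ft [measurable]:
  assumes [measurable]: "f \<in> borel_measurable borel"
  shows "ft f \<in> borel_measurable borel"
  unfolding ft_def by measurable

lemma integrable_iexp_mult:
  fixes f :: "'a::euclidean_space \<Rightarrow> complex"
  assumes f: "integrable lborel f"
  shows "integrable lborel (\<lambda>x. exp (- \<i> * complex_of_real (\<xi> \<bullet> x)) * f x)"
proof (rule Bochner_Integration.integrable_bound[OF f])
  have [measurable]: "f \<in> borel_measurable borel"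
    using borel_measurable_integrable[OF f] by simp
  show "(\<lambda>x. exp (- \<i> * complex_of_real (\<xi> \<bullet> x)) * f x) \<in> borel_measurable lborel"
    by measurable
qed (auto simp: norm_mult)

lemma cmod_ft_le:
  fixes f :: "'a::euclidean_space \<Rightarrow> complex"
  assumes f: "integrable lborel f"
  shows "cmod (ft f \<xi>) \<le> ft_const TYPE('a) * (\<integral>x. cmod (f x) \<partial>lborel)"
proof -
  have "cmod (\<integral>x. exp (- \<i> * complex_of_real (\<xi> \<bullet> x)) * f x \<partial>lborel)
      \<le> (\<integral>x. cmod (exp (- \<i> * complex_of_real (\<xi> \<bullet> x)) * f x) \<partial>lborel)"
    by (rule integral_norm_bound)
  also have "\<dots> = (\<integral>x. cmod (f x) \<partial>lborel)"
    by (simp add: norm_mult)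
  finally show ?thesis
    using ft_const_pos[where 'a='a] by (simp add: ft_def norm_mult mult_left_mono)
qed

lemma ft_linear:
  assumes "integrable lborel f" "integrable lborel g"
  shows "ft (\<lambda>x. a * f x + b * g x) \<xi> = a * ft f \<xi> + b * ft g \<xi>"
proof -
  have "(\<integral>x. exp (- \<i> * complex_of_real (\<xi> \<bullet> x)) * (a * f x + b * g x) \<partial>lborel)
      = (\<integral>x. a * (exp (- \<i> * complex_of_real (\<xi> \<bullet> x)) * f x)
           + b * (exp (- \<i> * complex_of_real (\<xi> \<bullet> x)) * g x) \<partial>lborel)"
    by (simp add: algebra_simps)
  also have "\<dots> = a * (\<integral>x. exp (- \<i> * complex_of_real (\<xi> \<bullet> x)) * f x \<partial>lborel)
      + b * (\<integral>x. exp (- \<i> * complex_of_real (\<xi> \<bullet> x)) * g x \<partial>lborel)"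
    using integrable_iexp_mult[OF assms(1)] integrable_iexp_mult[OF assms(2)]
    by (subst Bochner_Integration.integral_add) (auto simp del: mult_minus_left)
  finally show ?thesis
    by (simp add: ft_def algebra_simps)
qed

lemma ft_cong_AE:
  assumes [measurable]: "f \<in> borel_measurable borel" "g \<in> borel_measurable borel"
    and "AE x in lborel. f x = g x"
  shows "ft f = ft g"
proof
  fix \<xi>
  have "(\<integral>x. exp (- \<i> * complex_of_real (\<xi> \<bullet> x)) * f x \<partial>lborel)
      = (\<integral>x. exp (- \<i> * complex_of_real (\<xi> \<bullet> x)) * g x \<partial>lborel)"
    using assms(3) by (intro integral_cong_AE) auto
  then show "ft f \<xi> = ft g \<xi>" by (simp add: ft_def)
qed

text \<open>Fubini for a kernel that is symmetric in its two variables; the double integral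
  converges absolutely because the kernel has modulus 1.\<close>

lemma ft_multiplication:
  fixes f g :: "'a::euclidean_space \<Rightarrow> complex"
  assumes f: "integrable lborel f" and g: "integrable lborel g"
  shows "(\<integral>\<xi>. ft f \<xi> * g \<xi> \<partial>lborel) = (\<integral>x. f x * ft g x \<partial>lborel)"
proof -
  have [measurable]: "f \<in> borel_measurable borel" "g \<in> borel_measurable borel"
    using borel_measurable_integrable[OF f] borel_measurable_integrable[OF g] by simp_all
  let ?C = "complex_of_real (ft_const TYPE('a))"
  let ?h = "\<lambda>\<xi> x. exp (- \<i> * complex_of_real (\<xi> \<bullet> x)) * f x * g \<xi>"
  have "integrable (lborel \<Otimes>\<^sub>M lborel) (case_prod ?h)"
  proof (rule lborel_pair.Fubini_integrable)
    show "case_prod ?h \<in> borel_measurable (lborel \<Otimes>\<^sub>M lborel)"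
      by measurable
    have "integrable lborel (\<lambda>\<xi>. (\<integral>x. cmod (f x) \<partial>lborel) * cmod (g \<xi>))"
      using g by (intro integrable_mult_right integrable_norm)
    then show "integrable lborel (\<lambda>\<xi>. \<integral>x. norm (case_prod ?h (\<xi>, x)) \<partial>lborel)"
      by (simp add: norm_mult)
    show "AE \<xi> in lborel. integrable lborel (\<lambda>x. case_prod ?h (\<xi>, x))"
      using integrable_iexp_mult[OF f] by (auto simp del: mult_minus_left)
  qed
  from lborel_pair.Fubini_integral[OF this]
  have swap: "(\<integral>x. (\<integral>\<xi>. ?h \<xi> x \<partial>lborel) \<partial>lborel) = (\<integral>\<xi>. (\<integral>x. ?h \<xi> x \<partial>lborel) \<partial>lborel)" .
  have "(\<integral>\<xi>. ft f \<xi> * g \<xi> \<partial>lborel) = (\<integral>\<xi>. ?C * (\<integral>x. ?h \<xi> x \<partial>lborel) \<partial>lborel)"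
    by (subst integral_mult_left_zero) (simp only: ft_def mult.assoc)
  also have "\<dots> = ?C * (\<integral>x. (\<integral>\<xi>. ?h \<xi> x \<partial>lborel) \<partial>lborel)"
    by (simp only: swap integral_mult_right_zero)
  also have "\<dots> = (\<integral>x. ?C * (\<integral>\<xi>. ?h \<xi> x \<partial>lborel) \<partial>lborel)"
    by (simp only: integral_mult_right_zero)
  also have "\<dots> = (\<integral>x. f x * ft g x \<partial>lborel)"
  proof (intro Bochner_Integration.integral_cong refl)
    fix x
    have "(\<integral>\<xi>. ?h \<xi> x \<partial>lborel)
        = (\<integral>\<xi>. f x * (exp (- \<i> * complex_of_real (x \<bullet> \<xi>)) * g \<xi>) \<partial>lborel)"
      by (intro Bochner_Integration.integral_cong refl) (simp add: mult_ac inner_commute)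
    then show "?C * (\<integral>\<xi>. ?h \<xi> x \<partial>lborel) = f x * ft g x"
      by (simp only: integral_mult_right_zero ft_def mult.left_commute)
  qed
  finally show ?thesis .
qed

section \<open>Gaussian regularisation\<close>

lemma integrable_mult_gauss_scaled:
  fixes h :: "'a::euclidean_space \<Rightarrow> complex"
  assumes [measurable]: "h \<in> borel_measurable borel" and B: "\<And>x. cmod (h x) \<le> B" and s: "s > 0"
  shows "integrable lborel (\<lambda>x. h x * complex_of_real (gauss (s *\<^sub>R x)))"
proof (rule Bochner_Integration.integrable_bound)
  have "integrable lborel (\<lambda>x::'a. gauss (0 + s *\<^sub>R x))"
    using s by (intro lborel_integrable_affine integrable_gauss) auto
  then show "integrable lborel (\<lambda>x::'a. B * gauss (s *\<^sub>R x))"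
    by simp
  show "(\<lambda>x. h x * complex_of_real (gauss (s *\<^sub>R x))) \<in> borel_measurable lborel"
    by measurable
  have "cmod (h x) * gauss (s *\<^sub>R x) \<le> \<bar>B\<bar> * gauss (s *\<^sub>R x)" for x
    using B[of x] gauss_pos[of "s *\<^sub>R x"] by (intro mult_right_mono) auto
  then show "AE x in lborel. norm (h x * complex_of_real (gauss (s *\<^sub>R x))) \<le> norm (B * gauss (s *\<^sub>R x))"
    by (simp add: norm_mult abs_mult abs_of_pos[OF gauss_pos])
qed

text \<open>Modulation becomes translation, and dilation by s becomes dilation by 1/s with the
  factor s^(-n). Up to \<open>ft_const\<close> the result is a probability density in y that
  concentrates at -x as s tends to 0.\<close>

lemma ft_modulated_gauss:
  assumes s: "s > 0"
  shows "ft (\<lambda>\<xi>. exp (- \<i> * complex_of_real (x \<bullet> \<xi>)) * complex_of_real (gauss (s *\<^sub>R \<xi>))) y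
    = complex_of_real ((1 / s) ^ DIM('a) * gauss ((1 / s) *\<^sub>R (x + y :: 'a::euclidean_space)))"
proof -
  let ?F = "\<lambda>\<xi>. exp (- \<i> * complex_of_real ((x + y) \<bullet> \<xi>)) * complex_of_real (gauss (s *\<^sub>R \<xi>))"
  have "(\<integral>\<xi>. ?F \<xi> \<partial>lborel) = (\<bar>1 / s\<bar> ^ DIM('a)) *\<^sub>R (\<integral>\<xi>. ?F (0 + (1 / s) *\<^sub>R \<xi>) \<partial>lborel)"
    using s by (intro lborel_integral_affine) auto
  also have "(\<lambda>\<xi>. ?F (0 + (1 / s) *\<^sub>R \<xi>))
      = (\<lambda>\<xi>. exp (- \<i> * complex_of_real (((1 / s) *\<^sub>R (x + y)) \<bullet> \<xi>)) * complex_of_real (gauss \<xi>))"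
    using s by (auto simp: fun_eq_iff)
  finally have F: "(\<integral>\<xi>. ?F \<xi> \<partial>lborel) = (\<bar>1 / s\<bar> ^ DIM('a)) *\<^sub>R
      (\<integral>\<xi>. exp (- \<i> * complex_of_real (((1 / s) *\<^sub>R (x + y)) \<bullet> \<xi>)) * complex_of_real (gauss \<xi>) \<partial>lborel)"
    (is "_ = _ *\<^sub>R ?I") .
  have "complex_of_real (ft_const TYPE('a)) * ?I = complex_of_real (gauss ((1 / s) *\<^sub>R (x + y)))"
    by (rule integral_exp_gauss)
  then have *: "complex_of_real (ft_const TYPE('a)) * (\<integral>\<xi>. ?F \<xi> \<partial>lborel)
      = complex_of_real ((1 / s) ^ DIM('a)) * complex_of_real (gauss ((1 / s) *\<^sub>R (x + y)))"
    unfolding F using s by (simp only: scaleR_conv_of_real mult.left_commute) simp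
  have "exp (- \<i> * complex_of_real (y \<bullet> \<xi>)) *
      (exp (- \<i> * complex_of_real (x \<bullet> \<xi>)) * complex_of_real (gauss (s *\<^sub>R \<xi>))) = ?F \<xi>" for \<xi>
    by (simp add: inner_add_left exp_add[symmetric] algebra_simps flip: mult.assoc)
  then show ?thesis
    using * by (simp only: ft_def of_real_mult)
qed

text \<open>The Gaussian makes the outer integrand integrable, so the multiplication formula can
  move the inner \<open>ft\<close> from \<open>g\<close> onto the modulated Gaussian. What remains
  is an average of \<open>g\<close> around -x at scale s.\<close>

lemma ft_ft_gauss:
  fixes g :: "'a::euclidean_space \<Rightarrow> complex"
  assumes g: "integrable lborel g" and s: "s > 0"
  shows "ft (\<lambda>\<xi>. ft g \<xi> * complex_of_real (gauss (s *\<^sub>R \<xi>))) x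
    = complex_of_real (ft_const TYPE('a)) * (\<integral>u. g (s *\<^sub>R u - x) * complex_of_real (gauss u) \<partial>lborel)"
proof -
  have [measurable]: "g \<in> borel_measurable borel"
    using borel_measurable_integrable[OF g] by simp
  let ?C = "complex_of_real (ft_const TYPE('a))"
  let ?e = "\<lambda>\<xi>. exp (- \<i> * complex_of_real (x \<bullet> \<xi>)) * complex_of_real (gauss (s *\<^sub>R \<xi>))"
  let ?G = "\<lambda>y. g y * complex_of_real ((1 / s) ^ DIM('a) * gauss ((1 / s) *\<^sub>R (x + y)))"
  have e: "integrable lborel ?e"
    using s by (intro integrable_mult_gauss_scaled[where B=1]) auto
  have "ft (\<lambda>\<xi>. ft g \<xi> * complex_of_real (gauss (s *\<^sub>R \<xi>))) x = ?C * (\<integral>\<xi>. ft g \<xi> * ?e \<xi> \<partial>lborel)"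
    unfolding ft_def[of "\<lambda>\<xi>. ft g \<xi> * complex_of_real (gauss (s *\<^sub>R \<xi>))"] by (simp add: mult_ac)
  also have "\<dots> = ?C * (\<integral>y. ?G y \<partial>lborel)"
    by (simp only: ft_multiplication[OF g e] ft_modulated_gauss[OF s])
  \<comment> \<open>Substitution y = s u - x: its Jacobian s^n cancels (1/s)^n, and the Gaussian
    weight no longer depends on s.\<close>
  also have "(\<integral>y. ?G y \<partial>lborel) = (\<bar>s\<bar> ^ DIM('a)) *\<^sub>R (\<integral>u. ?G (- x + s *\<^sub>R u) \<partial>lborel)"
    using s by (intro lborel_integral_affine) auto
  also have "\<dots> = (\<integral>u. (\<bar>s\<bar> ^ DIM('a)) *\<^sub>R ?G (- x + s *\<^sub>R u) \<partial>lborel)"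
    by simp
  also have "\<dots> = (\<integral>u. g (s *\<^sub>R u - x) * complex_of_real (gauss u) \<partial>lborel)"
    using s by (intro Bochner_Integration.integral_cong refl)
      (simp add: scaleR_conv_of_real power_one_over)
  finally show ?thesis .
qed

lemma integral_ft_ft_gauss:
  fixes f g :: "'a::euclidean_space \<Rightarrow> complex"
  assumes f: "integrable lborel f" and g: "integrable lborel g" and s: "s > 0"
  shows "(\<integral>\<xi>. ft f \<xi> * ft g \<xi> * complex_of_real (gauss (s *\<^sub>R \<xi>)) \<partial>lborel)
    = (\<integral>x. f x * (complex_of_real (ft_const TYPE('a)) *
        (\<integral>u. g (s *\<^sub>R u - x) * complex_of_real (gauss u) \<partial>lborel)) \<partial>lborel)"
proof -
  have [measurable]: "g \<in> borel_measurable borel"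
    using borel_measurable_integrable[OF g] by simp
  have "integrable lborel (\<lambda>\<xi>. ft g \<xi> * complex_of_real (gauss (s *\<^sub>R \<xi>)))"
    by (rule integrable_mult_gauss_scaled[OF _ cmod_ft_le[OF g] s]) simp
  from ft_multiplication[OF f this] show ?thesis
    by (simp add: ft_ft_gauss[OF g s] mult_ac)
qed

section \<open>Contraction and weak inversion\<close>

text \<open>Conjugation flips the sign of the exponent and the substitution x -> -x flips it back.
  This is how |ft f|^2 arises from a formula without conjugates.\<close>

lemma ft_cnj_reflect:
  fixes f :: "'a::euclidean_space \<Rightarrow> complex"
  assumes [measurable]: "f \<in> borel_measurable borel"
  shows "ft (\<lambda>x. cnj (f (- x))) \<xi> = cnj (ft f \<xi>)"
proof -
  have "(\<integral>x. exp (- \<i> * complex_of_real (\<xi> \<bullet> x)) * cnj (f (- x)) \<partial>lborel)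
      = (\<bar>-1\<bar> ^ DIM('a)) *\<^sub>R (\<integral>x. exp (- \<i> * complex_of_real (\<xi> \<bullet> (0 + (-1) *\<^sub>R x)))
          * cnj (f (- (0 + (-1) *\<^sub>R x))) \<partial>lborel)"
    by (rule lborel_integral_affine) auto
  also have "\<dots> = (\<integral>x. cnj (exp (- \<i> * complex_of_real (\<xi> \<bullet> x)) * f x) \<partial>lborel)"
    by (simp add: exp_cnj)
  finally show ?thesis
    by (simp only: ft_def Bochner_Integration.integral_cnj[symmetric] complex_cnj_mult complex_cnj_complex_of_real)
qed

text \<open>For a non-integrable function the left side is 0 by the default value of the integral,
  so inner integrals can be estimated without first proving them integrable.\<close>

lemma norm_integral_le_nn_integral:
  fixes f :: "'a \<Rightarrow> 'b::{banach, second_countable_topology}"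
  shows "ennreal (norm (integral\<^sup>L M f)) \<le> (\<integral>\<^sup>+x. ennreal (norm (f x)) \<partial>M)"
  by (cases "integrable M f") (auto intro: integral_norm_bound_ennreal simp: not_integrable_integral_eq)

text \<open>From 2ab \<le> a^2 + b^2 and translation invariance; what matters is that the bound is
  uniform in the shift \<open>v\<close>.\<close>

lemma nn_integral_autocorrelation_le:
  fixes f :: "'a::euclidean_space \<Rightarrow> complex"
  assumes [measurable]: "f \<in> borel_measurable borel"
  shows "(\<integral>\<^sup>+x. ennreal (cmod (f x) * cmod (f (x - v))) \<partial>lborel) \<le> l2sq lborel f"
proof -
  have "2 * (\<integral>\<^sup>+x. ennreal (cmod (f x) * cmod (f (x - v))) \<partial>lborel)
      = (\<integral>\<^sup>+x. ennreal (2 * cmod (f x) * cmod (f (x - v))) \<partial>lborel)"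
    by (subst nn_integral_cmult[symmetric]) (auto simp: ennreal_mult mult.assoc)
  also have "\<dots> \<le> (\<integral>\<^sup>+x. ennreal ((cmod (f x))\<^sup>2) + ennreal ((cmod (f (x - v)))\<^sup>2) \<partial>lborel)"
    by (intro nn_integral_mono) (simp flip: ennreal_plus add: ennreal_leI sum_squares_bound)
  also have "\<dots> = l2sq lborel f + (\<integral>\<^sup>+x. ennreal ((cmod (f (- v + 1 *\<^sub>R x)))\<^sup>2) \<partial>lborel)"
    by (subst nn_integral_add) (auto simp: l2sq_def)
  also have "(\<integral>\<^sup>+x. ennreal ((cmod (f (- v + 1 *\<^sub>R x)))\<^sup>2) \<partial>lborel) = l2sq lborel f"
    unfolding l2sq_def by (rule nn_integral_lborel_affine) auto
  finally have "2 * (\<integral>\<^sup>+x. ennreal (cmod (f x) * cmod (f (x - v))) \<partial>lborel) \<le> 2 * l2sq lborel f"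
    by (simp add: mult_2)
  then show ?thesis
    by (simp add: ennreal_mult_le_mult_iff)
qed

lemma l2sq_reflect:
  fixes f :: "'a::euclidean_space \<Rightarrow> complex"
  assumes [measurable]: "f \<in> borel_measurable borel"
  shows "l2sq lborel (\<lambda>x. f (- x)) = l2sq lborel f"
  using nn_integral_lborel_affine[of "\<lambda>x. ennreal ((cmod (f x))\<^sup>2)" "-1" 0] by (simp add: l2sq_def)

text \<open>
  With \<open>g(x) = cnj (f(-x))\<close> the product \<open>\<F>f \<F>g\<close> is \<open>|\<F>f|\<^sup>2\<close>, and the other side of
  \<open>integral_ft_ft_gauss\<close> is a Gaussian average of autocorrelations of \<open>f\<close>.
\<close>

lemma nn_integral_ft_gauss_le:
  fixes f :: "'a::euclidean_space \<Rightarrow> complex"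
  assumes f: "integrable lborel f" and s: "s > 0"
  shows "(\<integral>\<^sup>+\<xi>. ennreal ((cmod (ft f \<xi>))\<^sup>2 * gauss (s *\<^sub>R \<xi>)) \<partial>lborel) \<le> l2sq lborel f"
proof -
  have [measurable]: "f \<in> borel_measurable borel"
    using borel_measurable_integrable[OF f] by simp
  let ?c = "ft_const TYPE('a)"
  note c = ft_const_pos[where 'a='a]
  define g where "g x = cnj (f (- x))" for x
  have [measurable]: "g \<in> borel_measurable borel"
    unfolding g_def by measurable
  have "integrable lborel (\<lambda>x. f (0 + (-1) *\<^sub>R x))"
    by (rule lborel_integrable_affine[OF f]) simp
  then have g: "integrable lborel g"
    unfolding g_def by simp
  have ftg: "ft g \<xi> = cnj (ft f \<xi>)" for \<xi>
    using ft_cnj_reflect[of f \<xi>] by (simp add: g_def[abs_def])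
  have sq: "ft f \<xi> * ft g \<xi> * complex_of_real (gauss (s *\<^sub>R \<xi>))
      = complex_of_real ((cmod (ft f \<xi>))\<^sup>2 * gauss (s *\<^sub>R \<xi>))" for \<xi>
    by (simp only: ftg of_real_mult complex_norm_square)
  \<comment> \<open>\<open>ft f\<close> and \<open>ft g\<close> are bounded, so the Gaussian makes
    their product integrable; taking norms then gives the real-valued statement.\<close>
  have "integrable lborel (\<lambda>\<xi>. (ft f \<xi> * ft g \<xi>) * complex_of_real (gauss (s *\<^sub>R \<xi>)))"
    using mult_mono[OF cmod_ft_le[OF f] cmod_ft_le[OF g]] s c
    by (intro integrable_mult_gauss_scaled[where B="(?c * (\<integral>x. cmod (f x) \<partial>lborel)) * (?c * (\<integral>x. cmod (g x) \<partial>lborel))"])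
       (auto simp: norm_mult)
  then have int: "integrable lborel (\<lambda>\<xi>. (cmod (ft f \<xi>))\<^sup>2 * gauss (s *\<^sub>R \<xi>))"
    unfolding sq by (drule_tac integrable_norm) (simp add: norm_mult norm_power abs_of_pos[OF gauss_pos])
  have "(\<integral>\<^sup>+\<xi>. ennreal ((cmod (ft f \<xi>))\<^sup>2 * gauss (s *\<^sub>R \<xi>)) \<partial>lborel)
      = ennreal (\<integral>\<xi>. (cmod (ft f \<xi>))\<^sup>2 * gauss (s *\<^sub>R \<xi>) \<partial>lborel)"
    by (rule nn_integral_eq_integral[OF int]) (simp add: less_imp_le[OF gauss_pos])
  also have "\<dots> \<le> ennreal (cmod (\<integral>\<xi>. ft f \<xi> * ft g \<xi> * complex_of_real (gauss (s *\<^sub>R \<xi>)) \<partial>lborel))"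
    unfolding sq by (simp only: integral_complex_of_real norm_of_real ennreal_leI[OF abs_ge_self])
  also have "\<dots> \<le> (\<integral>\<^sup>+x. ennreal (cmod (f x * (complex_of_real ?c *
        (\<integral>u. g (s *\<^sub>R u - x) * complex_of_real (gauss u) \<partial>lborel)))) \<partial>lborel)"
    unfolding integral_ft_ft_gauss[OF f g s] by (rule norm_integral_le_nn_integral)
  also have "\<dots> \<le> (\<integral>\<^sup>+x. (\<integral>\<^sup>+u. ennreal (?c * gauss u) *
        ennreal (cmod (f x) * cmod (f (x - s *\<^sub>R u))) \<partial>lborel) \<partial>lborel)"
  proof (intro nn_integral_mono)
    fix x
    have "ennreal (cmod (f x * (complex_of_real ?c * (\<integral>u. g (s *\<^sub>R u - x) * complex_of_real (gauss u) \<partial>lborel))))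
        = ennreal (cmod (f x) * ?c) * ennreal (cmod (\<integral>u. g (s *\<^sub>R u - x) * complex_of_real (gauss u) \<partial>lborel))"
      using c by (simp add: norm_mult mult_ac flip: ennreal_mult)
    also have "\<dots> \<le> ennreal (cmod (f x) * ?c) *
        (\<integral>\<^sup>+u. ennreal (cmod (g (s *\<^sub>R u - x) * complex_of_real (gauss u))) \<partial>lborel)"
      by (intro mult_left_mono norm_integral_le_nn_integral) auto
    also have "\<dots> = (\<integral>\<^sup>+u. ennreal (cmod (f x) * ?c) *
        ennreal (cmod (g (s *\<^sub>R u - x) * complex_of_real (gauss u))) \<partial>lborel)"
      by (rule nn_integral_cmult[symmetric]) measurable
    also have "\<dots> = (\<integral>\<^sup>+u. ennreal (?c * gauss u) * ennreal (cmod (f x) * cmod (f (x - s *\<^sub>R u))) \<partial>lborel)"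
      by (intro nn_integral_cong) (simp add: norm_mult g_def abs_of_pos[OF gauss_pos] less_imp_le[OF c]
          less_imp_le[OF gauss_pos] mult_ac flip: ennreal_mult)
    finally show "ennreal (cmod (f x * (complex_of_real ?c * (\<integral>u. g (s *\<^sub>R u - x) * complex_of_real (gauss u) \<partial>lborel))))
        \<le> (\<integral>\<^sup>+u. ennreal (?c * gauss u) * ennreal (cmod (f x) * cmod (f (x - s *\<^sub>R u))) \<partial>lborel)" .
  qed
  \<comment> \<open>After the swap the inner integral is an autocorrelation at shift
    \<open>s *\<^sub>R u\<close>, bounded by the squared norm of \<open>f\<close> for every
    \<open>u\<close>; the outer weight has total mass 1.\<close>
  also have "\<dots> = (\<integral>\<^sup>+u. (\<integral>\<^sup>+x. ennreal (?c * gauss u) *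
        ennreal (cmod (f x) * cmod (f (x - s *\<^sub>R u))) \<partial>lborel) \<partial>lborel)"
    by (rule lborel_pair.Fubini'[symmetric]) measurable
  also have "\<dots> \<le> (\<integral>\<^sup>+u. ennreal (?c * gauss (u::'a)) * l2sq lborel f \<partial>lborel)"
  proof (intro nn_integral_mono)
    fix u
    have "(\<integral>\<^sup>+x. ennreal (?c * gauss u) * ennreal (cmod (f x) * cmod (f (x - s *\<^sub>R u))) \<partial>lborel)
        = ennreal (?c * gauss u) * (\<integral>\<^sup>+x. ennreal (cmod (f x) * cmod (f (x - s *\<^sub>R u))) \<partial>lborel)"
      by (rule nn_integral_cmult) measurable
    also have "\<dots> \<le> ennreal (?c * gauss u) * l2sq lborel f"
      by (intro mult_left_mono nn_integral_autocorrelation_le) auto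
    finally show "(\<integral>\<^sup>+x. ennreal (?c * gauss u) * ennreal (cmod (f x) * cmod (f (x - s *\<^sub>R u))) \<partial>lborel)
        \<le> ennreal (?c * gauss u) * l2sq lborel f" .
  qed
  also have "\<dots> = (\<integral>\<^sup>+u. ennreal (?c * gauss (u::'a)) \<partial>lborel) * l2sq lborel f"
    by (rule nn_integral_multc) measurable
  also have "(\<integral>\<^sup>+u. ennreal (?c * gauss (u::'a)) \<partial>lborel) = 1"
    using integral_gauss[where 'a='a]
    by (subst nn_integral_eq_integral)
       (simp_all add: integrable_gauss less_imp_le[OF gauss_pos] less_imp_le[OF c])
  finally show ?thesis by simp
qed

section \<open>Removing the Gaussian factor\<close>

lemma gauss_tendsto_1:
  "(\<lambda>k. gauss (inverse (real (Suc k)) *\<^sub>R \<xi>)) \<longlonglongrightarrow> 1"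
proof -
  have "(\<lambda>k. gauss (inverse (real (Suc k)) *\<^sub>R \<xi>)) \<longlonglongrightarrow> gauss (0 *\<^sub>R \<xi>)"
    unfolding gauss_def by (intro tendsto_intros LIMSEQ_inverse_real_of_nat) auto
  then show ?thesis by (simp add: gauss_def)
qed

text \<open>Fatou's lemma: the Gaussian factor tends to 1 at every point while the bound of
  \<open>nn_integral_ft_gauss_le\<close> does not depend on s.\<close>

theorem l2sq_ft_le:
  fixes f :: "'a::euclidean_space \<Rightarrow> complex"
  assumes f: "integrable lborel f"
  shows "l2sq lborel (ft f) \<le> l2sq lborel f"
proof -
  have [measurable]: "f \<in> borel_measurable borel"
    using borel_measurable_integrable[OF f] by simp
  let ?s = "\<lambda>k. inverse (real (Suc k))"
  have "l2sq lborel (ft f)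
      = (\<integral>\<^sup>+\<xi>. liminf (\<lambda>k. ennreal ((cmod (ft f \<xi>))\<^sup>2 * gauss (?s k *\<^sub>R \<xi>))) \<partial>lborel)"
    unfolding l2sq_def
  proof (intro nn_integral_cong)
    fix \<xi> :: 'a
    have "(\<lambda>k. ennreal ((cmod (ft f \<xi>))\<^sup>2 * gauss (?s k *\<^sub>R \<xi>))) \<longlonglongrightarrow> ennreal ((cmod (ft f \<xi>))\<^sup>2 * 1)"
      by (intro tendsto_ennrealI tendsto_mult tendsto_const gauss_tendsto_1)
    from lim_imp_Liminf[OF sequentially_bot this]
    show "ennreal ((cmod (ft f \<xi>))\<^sup>2) = liminf (\<lambda>k. ennreal ((cmod (ft f \<xi>))\<^sup>2 * gauss (?s k *\<^sub>R \<xi>)))"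
      by simp
  qed
  also have "\<dots> \<le> liminf (\<lambda>k. \<integral>\<^sup>+\<xi>. ennreal ((cmod (ft f \<xi>))\<^sup>2 * gauss (?s k *\<^sub>R \<xi>)) \<partial>lborel)"
    by (intro nn_integral_liminf) measurable
  also have "\<dots> \<le> limsup (\<lambda>k. \<integral>\<^sup>+\<xi>. ennreal ((cmod (ft f \<xi>))\<^sup>2 * gauss (?s k *\<^sub>R \<xi>)) \<partial>lborel)"
    by (intro Liminf_le_Limsup) auto
  also have "\<dots> \<le> l2sq lborel f"
    by (intro Limsup_bounded always_eventually allI nn_integral_ft_gauss_le f) simp
  finally show ?thesis .
qed

text \<open>Continuity makes the Gaussian averages converge at every point, boundedness supplies the
  dominating functions, and integrability gives \<open>ft g\<close> as a genuine Fourier integral.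
  The class still separates L2 (\<open>AE_zero_if_test_integral_zero\<close>).\<close>

definition test_fun :: "('a::euclidean_space \<Rightarrow> complex) \<Rightarrow> bool" where
  "test_fun g \<longleftrightarrow> integrable lborel g \<and> continuous_on UNIV g \<and> bounded (range g)"

lemma test_fun_L2sp:
  assumes "test_fun g"
  shows "g \<in> L2sp lborel"
proof -
  obtain B where B: "\<And>x. cmod (g x) \<le> B"
    using assms by (auto simp: test_fun_def bounded_iff)
  have g: "integrable lborel g"
    using assms by (simp add: test_fun_def)
  then have [measurable]: "g \<in> borel_measurable borel"
    using borel_measurable_integrable by fastforce
  have "integrable lborel (\<lambda>x. (cmod (g x))\<^sup>2)"
  proof (rule Bochner_Integration.integrable_bound)
    show "integrable lborel (\<lambda>x. B * cmod (g x))"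
      using g by (intro integrable_mult_right integrable_norm)
    have "(cmod (g x))\<^sup>2 \<le> B * cmod (g x)" for x
      unfolding power2_eq_square by (intro mult_right_mono B) auto
    then show "AE x in lborel. norm ((cmod (g x))\<^sup>2) \<le> norm (B * cmod (g x))"
      by (auto intro: order_trans[OF _ abs_ge_self])
  qed measurable
  then show ?thesis by (simp add: L2sp_iff_integrable)
qed

lemma tendsto_gauss_average:
  fixes g :: "'a::euclidean_space \<Rightarrow> complex"
  assumes g: "continuous_on UNIV g" and B: "\<And>x. cmod (g x) \<le> B"
  shows "(\<lambda>k. complex_of_real (ft_const TYPE('a)) *
      (\<integral>u. g (inverse (real (Suc k)) *\<^sub>R u - x) * complex_of_real (gauss u) \<partial>lborel)) \<longlonglongrightarrow> g (- x)"
proof -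
  have [measurable]: "g \<in> borel_measurable borel"
    by (rule borel_measurable_continuous_onI[OF g])
  have "(\<lambda>k. \<integral>u. g (inverse (real (Suc k)) *\<^sub>R u - x) * complex_of_real (gauss u) \<partial>lborel)
      \<longlonglongrightarrow> (\<integral>u. g (- x) * complex_of_real (gauss (u::'a)) \<partial>lborel)"
  proof (rule integral_dominated_convergence)
    show "integrable lborel (\<lambda>u::'a. B * gauss u)"
      by (intro integrable_mult_right integrable_gauss)
    show "AE u in lborel. (\<lambda>k. g (inverse (real (Suc k)) *\<^sub>R u - x) * complex_of_real (gauss u))
        \<longlonglongrightarrow> g (- x) * complex_of_real (gauss u)"
    proof (intro always_eventually allI tendsto_mult tendsto_const)
      fix u :: 'a
      have "(\<lambda>k. inverse (real (Suc k)) *\<^sub>R u - x) \<longlonglongrightarrow> 0 *\<^sub>R u - x"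
        by (intro tendsto_intros LIMSEQ_inverse_real_of_nat)
      then have lim: "(\<lambda>k. inverse (real (Suc k)) *\<^sub>R u - x) \<longlonglongrightarrow> - x" by simp
      show "(\<lambda>k. g (inverse (real (Suc k)) *\<^sub>R u - x)) \<longlonglongrightarrow> g (- x)"
        by (rule continuous_on_tendsto_compose[OF g lim]) auto
    qed
    show "AE u in lborel. norm (g (inverse (real (Suc k)) *\<^sub>R u - x) * complex_of_real (gauss u))
        \<le> B * gauss u" for k
      using B by (auto simp: norm_mult abs_of_pos[OF gauss_pos] intro!: mult_right_mono less_imp_le[OF gauss_pos])
  qed measurable
  then have "(\<lambda>k. complex_of_real (ft_const TYPE('a)) *
      (\<integral>u. g (inverse (real (Suc k)) *\<^sub>R u - x) * complex_of_real (gauss u) \<partial>lborel))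
      \<longlonglongrightarrow> complex_of_real (ft_const TYPE('a)) * (\<integral>u. g (- x) * complex_of_real (gauss (u::'a)) \<partial>lborel)"
    by (intro tendsto_mult tendsto_const)
  also have "complex_of_real (ft_const TYPE('a)) * (\<integral>u. g (- x) * complex_of_real (gauss (u::'a)) \<partial>lborel)
      = g (- x) * complex_of_real (ft_const TYPE('a) * (\<integral>u. gauss (u::'a) \<partial>lborel))"
    by simp
  finally show ?thesis
    by (simp only: integral_gauss) simp
qed

text \<open>Averaging against a probability density preserves a bound, uniformly in \<open>s\<close>
  and \<open>x\<close>; this gives the majorant for the right-hand limit in
  \<open>integral_ft_ft\<close>.\<close>

lemma cmod_gauss_average_le:
  fixes g :: "'a::euclidean_space \<Rightarrow> complex"
  assumes B: "\<And>x. cmod (g x) \<le> B" and [measurable]: "g \<in> borel_measurable borel"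
  shows "cmod (complex_of_real (ft_const TYPE('a)) *
      (\<integral>u. g (s *\<^sub>R u - x) * complex_of_real (gauss u) \<partial>lborel)) \<le> B"
proof -
  have bd: "cmod (g (s *\<^sub>R u - x) * complex_of_real (gauss u)) \<le> B * gauss u" for u
    using B by (auto simp: norm_mult abs_of_pos[OF gauss_pos] intro!: mult_right_mono less_imp_le[OF gauss_pos])
  have "cmod (\<integral>u. g (s *\<^sub>R u - x) * complex_of_real (gauss u) \<partial>lborel) \<le> (\<integral>u. B * gauss (u::'a) \<partial>lborel)"
  proof (rule Bochner_Integration.integral_norm_bound_integral)
    show "integrable lborel (\<lambda>u. g (s *\<^sub>R u - x) * complex_of_real (gauss u))"
      using integrable_mult_gauss_scaled[of "\<lambda>u. g (s *\<^sub>R u - x)" B 1] B by simp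
    show "integrable lborel (\<lambda>u::'a. B * gauss u)"
      by (intro integrable_mult_right integrable_gauss)
  qed (rule bd)
  then have "ft_const TYPE('a) * cmod (\<integral>u. g (s *\<^sub>R u - x) * complex_of_real (gauss u) \<partial>lborel)
      \<le> ft_const TYPE('a) * (B * (\<integral>u. gauss (u::'a) \<partial>lborel))"
    using ft_const_pos[where 'a='a] by (intro mult_left_mono) auto
  also have "\<dots> = B * (ft_const TYPE('a) * (\<integral>u. gauss (u::'a) \<partial>lborel))"
    by simp
  finally show ?thesis
    using ft_const_pos[where 'a='a] by (simp add: integral_gauss norm_mult)
qed

text \<open>Both sides are limits of the same regularised identity. The majorant on the left comes
  from the contraction estimate: both transforms are in L2, so their product is integrable.\<close>

lemma integral_ft_ft:
  fixes f g :: "'a::euclidean_space \<Rightarrow> complex"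
  assumes f: "integrable lborel f" "f \<in> L2sp lborel" and g: "test_fun g"
  shows "(\<integral>\<xi>. ft f \<xi> * ft g \<xi> \<partial>lborel) = (\<integral>x. f x * g (- x) \<partial>lborel)"
proof -
  let ?s = "\<lambda>k. inverse (real (Suc k))"
  let ?A = "\<lambda>k x. complex_of_real (ft_const TYPE('a)) *
      (\<integral>u. g (?s k *\<^sub>R u - x) * complex_of_real (gauss u) \<partial>lborel)"
  have gi: "integrable lborel g" and gc: "continuous_on UNIV g"
    using g by (auto simp: test_fun_def)
  obtain B where B: "\<And>x. cmod (g x) \<le> B"
    using g by (auto simp: test_fun_def bounded_iff)
  have [measurable]: "f \<in> borel_measurable borel" "g \<in> borel_measurable borel"
    using borel_measurable_integrable[OF f(1)] borel_measurable_integrable[OF gi] by simp_all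
  have ft_L2: "ft h \<in> L2sp lborel" if "integrable lborel h" "h \<in> L2sp lborel" for h :: "'a \<Rightarrow> complex"
    using that l2sq_ft_le[OF that(1)] borel_measurable_integrable[OF that(1)]
    by (auto simp: L2sp_def)
  have int: "integrable lborel (\<lambda>\<xi>. ft f \<xi> * ft g \<xi>)"
    by (intro integrable_L2sp_mult ft_L2 f gi test_fun_L2sp g)
  have lim1: "(\<lambda>k. \<integral>\<xi>. ft f \<xi> * ft g \<xi> * complex_of_real (gauss (?s k *\<^sub>R \<xi>)) \<partial>lborel)
      \<longlonglongrightarrow> (\<integral>\<xi>. ft f \<xi> * ft g \<xi> \<partial>lborel)"
  proof (rule integral_dominated_convergence)
    show "integrable lborel (\<lambda>\<xi>. cmod (ft f \<xi> * ft g \<xi>))"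
      using int by (rule integrable_norm)
    show "AE \<xi> in lborel. (\<lambda>k. ft f \<xi> * ft g \<xi> * complex_of_real (gauss (?s k *\<^sub>R \<xi>)))
        \<longlonglongrightarrow> ft f \<xi> * ft g \<xi>"
    proof (intro always_eventually allI)
      fix \<xi> :: 'a
      have "(\<lambda>k. ft f \<xi> * ft g \<xi> * complex_of_real (gauss (?s k *\<^sub>R \<xi>)))
          \<longlonglongrightarrow> ft f \<xi> * ft g \<xi> * complex_of_real 1"
        by (intro tendsto_mult tendsto_const tendsto_of_real gauss_tendsto_1)
      then show "(\<lambda>k. ft f \<xi> * ft g \<xi> * complex_of_real (gauss (?s k *\<^sub>R \<xi>))) \<longlonglongrightarrow> ft f \<xi> * ft g \<xi>"
        by simp
    qed
    show "AE \<xi> in lborel. norm (ft f \<xi> * ft g \<xi> * complex_of_real (gauss (?s k *\<^sub>R \<xi>)))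
        \<le> cmod (ft f \<xi> * ft g \<xi>)" for k
      by (auto simp: norm_mult abs_of_pos[OF gauss_pos] gauss_le_1 intro!: mult_right_le_one_le less_imp_le[OF gauss_pos])
  qed measurable
  have lim2: "(\<lambda>k. \<integral>x. f x * ?A k x \<partial>lborel) \<longlonglongrightarrow> (\<integral>x. f x * g (- x) \<partial>lborel)"
  proof (rule integral_dominated_convergence)
    show "integrable lborel (\<lambda>x. cmod (f x) * B)"
      using f(1) by (intro integrable_mult_left integrable_norm)
    show "AE x in lborel. (\<lambda>k. f x * ?A k x) \<longlonglongrightarrow> f x * g (- x)"
      by (intro always_eventually allI tendsto_mult tendsto_const tendsto_gauss_average[OF gc B])
    show "AE x in lborel. norm (f x * ?A k x) \<le> cmod (f x) * B" for k
      unfolding norm_mult[of "f _"]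
      by (intro always_eventually allI mult_left_mono cmod_gauss_average_le[OF B]) auto
  qed measurable
  have eq: "(\<integral>\<xi>. ft f \<xi> * ft g \<xi> * complex_of_real (gauss (?s k *\<^sub>R \<xi>)) \<partial>lborel)
      = (\<integral>x. f x * ?A k x \<partial>lborel)" for k
    by (rule integral_ft_ft_gauss[OF f(1) gi]) simp
  show ?thesis
    by (rule LIMSEQ_unique[OF lim1[unfolded eq] lim2])
qed

section \<open>Extension to square-integrable functions\<close>

lemma gauss_L2sp: "(\<lambda>x. complex_of_real (gauss x)) \<in> L2sp lborel"
  unfolding L2sp_iff_integrable
proof
  show "integrable lborel (\<lambda>x. (cmod (complex_of_real (gauss x)))\<^sup>2)"
  proof (rule Bochner_Integration.integrable_bound[OF integrable_gauss])
    show "AE x in lborel. norm ((cmod (complex_of_real (gauss x)))\<^sup>2) \<le> norm (gauss x)"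
      by (auto simp: power2_eq_square abs_of_pos[OF gauss_pos] gauss_le_1
          intro!: mult_left_le less_imp_le[OF gauss_pos])
  qed measurable
qed measurable

text \<open>Off a closed set the distance is positive, so the bump is eventually 0 there. The empty
  set is excluded because \<open>infdist x {} = 0\<close> would make the bump constantly 1.\<close>

lemma bump_tendsto_indicator:
  assumes "closed S" "S \<noteq> {}"
  shows "(\<lambda>j. max 0 (1 - real j * infdist x S)) \<longlonglongrightarrow> indicat_real S x"
proof (cases "x \<in> S")
  case True
  then show ?thesis by simp
next
  case False
  then have pos: "infdist x S > 0"
    using in_closed_iff_infdist_zero[OF assms] infdist_nonneg[of x S] by (simp add: less_le)
  obtain N where N: "1 / infdist x S < real N"
    using reals_Archimedean2 by blast
  have "max 0 (1 - real j * infdist x S) = 0" if "j \<ge> N" for j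
  proof -
    have "1 / infdist x S < real j" using N that by simp
    then have "1 < real j * infdist x S" using pos by (simp add: field_simps)
    then show ?thesis by simp
  qed
  then have "(\<lambda>j. max 0 (1 - real j * infdist x S)) \<longlonglongrightarrow> 0"
    by (intro tendsto_eventually eventually_sequentiallyI[of N])
  with False show ?thesis by simp
qed

text \<open>Closed sets are stable under intersection and generate the Borel sets, so a Dynkin
  argument extends the vanishing to all Borel sets; complements use that \<open>UNIV\<close> is
  closed.\<close>

lemma AE_zero_if_closed_integral_zero:
  fixes v :: "'a::euclidean_space \<Rightarrow> complex"
  assumes v: "integrable lborel v"
    and closed: "\<And>S. closed S \<Longrightarrow> (\<integral>x\<in>S. v x \<partial>lborel) = 0"
  shows "AE x in lborel. v x = 0"
proof (rule sigma_finite_measure.density_zero[OF sigma_finite_lborel v])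
  fix A :: "'a set" assume A: "A \<in> sets lborel"
  have si: "set_integrable lborel B v" if "B \<in> sets borel" for B
    using that v unfolding set_integrable_def by (intro integrable_mult_indicator) auto
  have sets: "sigma_sets UNIV (Collect closed) = sets (borel :: 'a measure)"
    unfolding borel_eq_closed by (simp add: sets_measure_of)
  have "Int_stable (Collect closed :: 'a set set)" "Collect closed \<subseteq> Pow (UNIV :: 'a set)"
    by (auto simp: Int_stable_def)
  moreover have "A \<in> sigma_sets UNIV (Collect closed)"
    using A by (simp add: sets)
  ultimately show "(\<integral>x\<in>A. v x \<partial>lborel) = 0"
  proof (induction rule: sigma_sets_induct_disjoint)
    case (basic A)
    then show ?case using closed by simp
  next
    case empty
    show ?case by (simp add: set_lebesgue_integral_def)
  next
    case (compl A)
    then have [measurable]: "A \<in> sets borel" by (simp add: sets)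
    have "(\<integral>x\<in>A \<union> (UNIV - A). v x \<partial>lborel) = (\<integral>x\<in>A. v x \<partial>lborel) + (\<integral>x\<in>UNIV - A. v x \<partial>lborel)"
      by (intro set_integral_Un si) auto
    moreover have "A \<union> (UNIV - A) = UNIV" by auto
    ultimately show ?case using compl closed[of UNIV] by simp
  next
    case (union A)
    then have [measurable]: "A i \<in> sets borel" for i by (auto simp: sets)
    have "(\<integral>x\<in>(\<Union>i. A i). v x \<partial>lborel) = (\<Sum>i. \<integral>x\<in>A i. v x \<partial>lborel)"
      using union(1) by (intro lebesgue_integral_countable_add si) (auto simp: disjoint_family_on_def)
    then show ?case using union by simp
  qed
qed

text \<open>\<open>u\<close> need not be integrable, but \<open>u\<close> times the Gaussian is, and
  it has the same zeros. Moved to the other factor, the Gaussian turns the bumps around a closed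
  set, which need not be integrable, into test functions.\<close>

lemma AE_zero_if_test_integral_zero:
  fixes u :: "'a::euclidean_space \<Rightarrow> complex"
  assumes u: "u \<in> L2sp lborel"
    and test: "\<And>g. test_fun g \<Longrightarrow> (\<integral>x. u x * g x \<partial>lborel) = 0"
  shows "AE x in lborel. u x = 0"
proof -
  define v where "v x = u x * complex_of_real (gauss x)" for x
  have v: "integrable lborel v"
    unfolding v_def by (rule integrable_L2sp_mult[OF u gauss_L2sp])
  have [measurable]: "v \<in> borel_measurable borel"
    using borel_measurable_integrable[OF v] by simp
  have "AE x in lborel. v x = 0"
  proof (rule AE_zero_if_closed_integral_zero[OF v])
    fix S :: "'a set" assume "closed S"
    show "(\<integral>x\<in>S. v x \<partial>lborel) = 0"
    proof (cases "S = {}")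
      case True
      then show ?thesis by (simp add: set_lebesgue_integral_def)
    next
      case False
      have [measurable]: "S \<in> sets borel" using \<open>closed S\<close> by simp
      define b where "b j x = max 0 (1 - real j * infdist x S)" for j x
      have bc: "continuous_on UNIV (b j)" for j
        unfolding b_def by (intro continuous_intros)
      then have [measurable]: "b j \<in> borel_measurable borel" for j
        by (intro borel_measurable_continuous_onI)
      have b: "0 \<le> b j x" "b j x \<le> 1" for j x
        by (auto simp: b_def infdist_nonneg)
      have "test_fun (\<lambda>x. complex_of_real (b j x) * complex_of_real (gauss x))" for j
        unfolding test_fun_def
      proof (intro conjI)
        show "integrable lborel (\<lambda>x. complex_of_real (b j x) * complex_of_real (gauss x))"
          using integrable_mult_gauss_scaled[of "\<lambda>x. complex_of_real (b j x)" 1 1] b by simp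
        show "continuous_on UNIV (\<lambda>x. complex_of_real (b j x) * complex_of_real (gauss x))"
          using continuous_on_gauss[of UNIV 1] by (intro continuous_intros bc) auto
        have "b j x * gauss x \<le> 1" for x
          using b[of j x] gauss_pos[of x] gauss_le_1[of x] by (intro mult_le_one) auto
        then show "bounded (range (\<lambda>x. complex_of_real (b j x) * complex_of_real (gauss x)))"
          using b by (auto simp: bounded_iff norm_mult abs_of_pos[OF gauss_pos] intro!: exI[of _ 1])
      qed
      then have "(\<integral>x. u x * (complex_of_real (b j x) * complex_of_real (gauss x)) \<partial>lborel) = 0" for j
        by (rule test)
      then have zero: "(\<integral>x. b j x *\<^sub>R v x \<partial>lborel) = 0" for j
        by (simp add: v_def scaleR_conv_of_real mult_ac)
      have "(\<lambda>j. \<integral>x. b j x *\<^sub>R v x \<partial>lborel) \<longlonglongrightarrow> (\<integral>x. indicat_real S x *\<^sub>R v x \<partial>lborel)"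
      proof (rule integral_dominated_convergence)
        show "integrable lborel (\<lambda>x. cmod (v x))"
          using v by (rule integrable_norm)
        show "AE x in lborel. (\<lambda>j. b j x *\<^sub>R v x) \<longlonglongrightarrow> indicat_real S x *\<^sub>R v x"
          unfolding b_def
          by (intro always_eventually allI tendsto_scaleR tendsto_const bump_tendsto_indicator \<open>closed S\<close> False)
        show "AE x in lborel. norm (b j x *\<^sub>R v x) \<le> cmod (v x)" for j
          using b by (auto intro!: mult_left_le_one_le)
      qed measurable
      then have "(\<integral>x. indicat_real S x *\<^sub>R v x \<partial>lborel) = 0"
        unfolding zero by (rule LIMSEQ_unique[OF _ tendsto_const])
      then show ?thesis by (simp add: set_lebesgue_integral_def)
    qed
  qed
  then show ?thesis
    by eventually_elim (use gauss_pos in \<open>auto simp: v_def less_le\<close>)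
qed

section \<open>Truncation to balls and the L2 extension\<close>

definition trunc_ball :: "nat \<Rightarrow> ('a::euclidean_space \<Rightarrow> complex) \<Rightarrow> 'a \<Rightarrow> complex" where
  "trunc_ball k f x = indicat_real (cball 0 (real k)) x *\<^sub>R f x"

lemma borel_measurable_trunc_ball [measurable]:
  "(f :: 'a::euclidean_space \<Rightarrow> complex) \<in> borel_measurable borel \<Longrightarrow> trunc_ball k f \<in> borel_measurable borel"
proof -
  assume [measurable]: "f \<in> borel_measurable borel"
  have [measurable]: "cball (0::'a) (real k) \<in> sets borel" by simp
  show ?thesis unfolding trunc_ball_def[abs_def] by measurable
qed

lemma trunc_ball_L2sp: "f \<in> L2sp lborel \<Longrightarrow> trunc_ball k f \<in> L2sp lborel"
proof -
  assume f: "f \<in> L2sp lborel"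
  then have [measurable]: "f \<in> borel_measurable borel" by (simp add: L2sp_def)
  have "l2sq lborel (trunc_ball k f) \<le> l2sq lborel f"
    unfolding l2sq_def by (intro nn_integral_mono) (auto simp: trunc_ball_def indicator_def)
  with f show ?thesis by (auto simp: L2sp_def)
qed

text \<open>A ball has finite measure, so its indicator is in L2, and a product of two L2 functions
  is integrable.\<close>

lemma trunc_ball_integrable:
  fixes f :: "'a::euclidean_space \<Rightarrow> complex"
  assumes f: "f \<in> L2sp lborel"
  shows "integrable lborel (trunc_ball k f)"
proof -
  have [measurable]: "cball (0::'a) (real k) \<in> sets borel" by simp
  have "integrable lborel (indicat_real (cball (0::'a) (real k)))"
    using emeasure_lborel_cball_finite[of "0::'a" "real k"] by (intro integrable_real_indicator) auto
  moreover have "(cmod (complex_of_real (indicat_real A x)))\<^sup>2 = indicat_real A x" for A and x :: 'a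
    by (simp add: indicator_def)
  ultimately have "(\<lambda>x::'a. complex_of_real (indicat_real (cball 0 (real k)) x)) \<in> L2sp lborel"
    by (simp only: L2sp_iff_integrable) measurable
  from integrable_L2sp_mult[OF this f] show ?thesis
    by (simp add: trunc_ball_def[abs_def] scaleR_conv_of_real)
qed

text \<open>The error is dominated by |f|^2 and vanishes at each point once the ball contains
  it.\<close>

lemma trunc_ball_tendsto:
  fixes f :: "'a::euclidean_space \<Rightarrow> complex"
  assumes f: "f \<in> L2sp lborel"
  shows "(\<lambda>k. l2sq lborel (\<lambda>x. trunc_ball k f x - f x)) \<longlonglongrightarrow> 0"
proof -
  have [measurable]: "f \<in> borel_measurable borel" using f by (simp add: L2sp_def)
  have "(\<lambda>k. \<integral>\<^sup>+x. ennreal ((cmod (trunc_ball k f x - f x))\<^sup>2) \<partial>lborel) \<longlonglongrightarrow> (\<integral>\<^sup>+x. 0 \<partial>(lborel :: 'a measure))"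
  proof (rule nn_integral_dominated_convergence)
    show "AE x in lborel. ennreal ((cmod (trunc_ball k f x - f x))\<^sup>2) \<le> ennreal ((cmod (f x))\<^sup>2)" for k
      by (auto simp: trunc_ball_def indicator_def)
    show "(\<integral>\<^sup>+x. ennreal ((cmod (f x))\<^sup>2) \<partial>lborel) < \<infinity>"
      using L2sp_finite[OF f] by (simp add: l2sq_def)
    show "AE x in lborel. (\<lambda>k. ennreal ((cmod (trunc_ball k f x - f x))\<^sup>2)) \<longlonglongrightarrow> 0"
    proof (rule AE_I2, rule tendsto_eventually)
      fix x :: 'a
      obtain N where N: "norm x \<le> real N" using real_arch_simple by blast
      show "\<forall>\<^sub>F k in sequentially. ennreal ((cmod (trunc_ball k f x - f x))\<^sup>2) = 0"
        by (intro eventually_sequentiallyI[of N]) (use N in \<open>auto simp: trunc_ball_def\<close>)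
    qed
  qed measurable
  then show ?thesis by (simp add: l2sq_def)
qed

lemma ft_L2sp:
  assumes "integrable lborel f" "f \<in> L2sp lborel"
  shows "ft f \<in> L2sp lborel"
  using assms l2sq_ft_le[OF assms(1)] by (auto simp: L2sp_def)

lemma l2sq_ft_diff_le:
  assumes "integrable lborel f" "integrable lborel g"
  shows "l2sq lborel (\<lambda>\<xi>. ft f \<xi> - ft g \<xi>) \<le> l2sq lborel (\<lambda>x. f x - g x)"
proof -
  have "ft (\<lambda>x. f x - g x) = (\<lambda>\<xi>. ft f \<xi> - ft g \<xi>)"
    using ft_linear[OF assms, of 1 "-1"] by (simp add: fun_eq_iff)
  then show ?thesis
    using l2sq_ft_le[of "\<lambda>x. f x - g x"] assms by simp
qed

text \<open>\<open>SOME\<close> picks one representative of an L2 limit. The choice depends on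
  \<open>f\<close> only through the transforms of its truncations.\<close>

definition plancherel :: "('a::euclidean_space \<Rightarrow> complex) \<Rightarrow> 'a \<Rightarrow> complex" where
  "plancherel f = (SOME g. g \<in> L2sp lborel \<and>
     (\<lambda>k. l2sq lborel (\<lambda>\<xi>. ft (trunc_ball k f) \<xi> - g \<xi>)) \<longlonglongrightarrow> 0)"

lemma ft_trunc_ball_L2sp: "f \<in> L2sp lborel \<Longrightarrow> ft (trunc_ball k f) \<in> L2sp lborel"
  by (intro ft_L2sp trunc_ball_integrable trunc_ball_L2sp)

lemma plancherel_spec:
  fixes f :: "'a::euclidean_space \<Rightarrow> complex"
  assumes f: "f \<in> L2sp lborel"
  shows "plancherel f \<in> L2sp lborel"
    and "(\<lambda>k. l2sq lborel (\<lambda>\<xi>. ft (trunc_ball k f) \<xi> - plancherel f \<xi>)) \<longlonglongrightarrow> 0"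
proof -
  have [measurable]: "f \<in> borel_measurable borel" using f by (simp add: L2sp_def)
  let ?d = "\<lambda>k. l2sq lborel (\<lambda>x. trunc_ball k f x - f x)"
  have bound: "l2sq lborel (\<lambda>\<xi>. ft (trunc_ball m f) \<xi> - ft (trunc_ball n f) \<xi>) \<le> 2 * ?d m + 2 * ?d n"
    for m n
  proof -
    have "l2sq lborel (\<lambda>\<xi>. ft (trunc_ball m f) \<xi> - ft (trunc_ball n f) \<xi>)
        \<le> l2sq lborel (\<lambda>x. trunc_ball m f x - trunc_ball n f x)"
      by (intro l2sq_ft_diff_le trunc_ball_integrable f)
    also have "\<dots> \<le> 2 * ?d m + 2 * l2sq lborel (\<lambda>x. f x - trunc_ball n f x)"
      by (rule l2sq_triangle) auto
    finally show ?thesis by (simp add: l2sq_minus_commute[of _ f])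
  qed
  have "\<exists>g \<in> L2sp lborel. (\<lambda>k. l2sq lborel (\<lambda>\<xi>. ft (trunc_ball k f) \<xi> - g \<xi>)) \<longlonglongrightarrow> 0"
  proof (rule L2sp_complete)
    show "ft (trunc_ball k f) \<in> L2sp lborel" for k
      by (rule ft_trunc_ball_L2sp[OF f])
    fix e :: real assume e: "0 < e"
    \<comment> \<open>The 4 arises because \<open>bound\<close> has two terms, each with a factor
      2.\<close>
    then have "\<forall>\<^sub>F k in sequentially. ?d k < ennreal (e / 4)"
      by (intro order_tendstoD(2)[OF trunc_ball_tendsto[OF f]]) simp
    then obtain N where N: "\<And>k. k \<ge> N \<Longrightarrow> ?d k < ennreal (e / 4)"
      by (auto simp: eventually_sequentially)
    have "l2sq lborel (\<lambda>\<xi>. ft (trunc_ball m f) \<xi> - ft (trunc_ball n f) \<xi>) \<le> ennreal e"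
      if "m \<ge> N" "n \<ge> N" for m n
    proof -
      have "2 * ?d m + 2 * ?d n \<le> 2 * ennreal (e / 4) + 2 * ennreal (e / 4)"
        by (intro add_mono mult_left_mono less_imp_le N that) auto
      also have "\<dots> = ennreal (2 * (e / 4) + 2 * (e / 4))"
        using e by (simp only: ennreal_plus ennreal_mult) (simp add: ennreal_mult')
      also have "\<dots> = ennreal e" by simp
      finally show ?thesis using bound[of m n] by (rule order_trans[rotated])
    qed
    then show "\<exists>N. \<forall>m\<ge>N. \<forall>n\<ge>N.
        l2sq lborel (\<lambda>\<xi>. ft (trunc_ball m f) \<xi> - ft (trunc_ball n f) \<xi>) \<le> ennreal e"
      by blast
  qed
  then have "\<exists>g. g \<in> L2sp lborel \<and> (\<lambda>k. l2sq lborel (\<lambda>\<xi>. ft (trunc_ball k f) \<xi> - g \<xi>)) \<longlonglongrightarrow> 0"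
    by blast
  from someI_ex[OF this, folded plancherel_def]
  show "plancherel f \<in> L2sp lborel"
    and "(\<lambda>k. l2sq lborel (\<lambda>\<xi>. ft (trunc_ball k f) \<xi> - plancherel f \<xi>)) \<longlonglongrightarrow> 0"
    by auto
qed

text \<open>L2 limits are unique almost everywhere, so \<open>plancherel f\<close> is identified by
  exhibiting another limit of the same truncated transforms.\<close>

lemma plancherel_eqI:
  assumes f: "f \<in> L2sp lborel" and g: "g \<in> borel_measurable borel"
    and lim: "(\<lambda>k. l2sq lborel (\<lambda>\<xi>. ft (trunc_ball k f) \<xi> - g \<xi>)) \<longlonglongrightarrow> 0"
  shows "AE \<xi> in lborel. plancherel f \<xi> = g \<xi>"
proof (rule L2sp_limit_unique[OF _ _ _ plancherel_spec(2)[OF f] lim])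
  show "ft (trunc_ball k f) \<in> borel_measurable lborel" for k
    using ft_trunc_ball_L2sp[OF f] by (rule L2sp_measurable)
  show "plancherel f \<in> borel_measurable lborel"
    using plancherel_spec(1)[OF f] by (rule L2sp_measurable)
  show "g \<in> borel_measurable lborel" using g by simp
qed

text \<open>Equality holds everywhere: changing \<open>f\<close> on a null set changes no Fourier
  integral, so \<open>SOME\<close> is applied to the same predicate.\<close>

lemma plancherel_cong_AE:
  assumes "f \<in> borel_measurable borel" "g \<in> borel_measurable borel"
    and "AE x in lborel. f x = g x"
  shows "plancherel f = plancherel g"
proof -
  have "ft (trunc_ball k f) = ft (trunc_ball k g)" for k
    using assms by (intro ft_cong_AE) (auto simp: trunc_ball_def)
  then show ?thesis by (simp add: plancherel_def)
qed

lemma plancherel_eq_ft: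
  assumes f: "f \<in> L2sp lborel" and int: "integrable lborel f"
  shows "AE \<xi> in lborel. plancherel f \<xi> = ft f \<xi>"
proof (rule plancherel_eqI[OF f])
  have [measurable]: "f \<in> borel_measurable borel" using f by (simp add: L2sp_def)
  show "ft f \<in> borel_measurable borel" by measurable
  show "(\<lambda>k. l2sq lborel (\<lambda>\<xi>. ft (trunc_ball k f) \<xi> - ft f \<xi>)) \<longlonglongrightarrow> 0"
    by (rule tendsto_sandwich[OF _ _ tendsto_const trunc_ball_tendsto[OF f]])
       (auto intro!: always_eventually l2sq_ft_diff_le trunc_ball_integrable f int)
qed

section \<open>The Plancherel theorem\<close>

lemma plancherel_linear:
  fixes f g :: "'a::euclidean_space \<Rightarrow> complex"
  assumes f: "f \<in> L2sp lborel" and g: "g \<in> L2sp lborel"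
  shows "AE \<xi> in lborel. plancherel (\<lambda>x. a * f x + b * g x) \<xi> = a * plancherel f \<xi> + b * plancherel g \<xi>"
proof (rule plancherel_eqI)
  have [measurable]: "plancherel f \<in> borel_measurable borel" "plancherel g \<in> borel_measurable borel"
      "f \<in> borel_measurable borel" "g \<in> borel_measurable borel"
    using plancherel_spec(1)[OF f] plancherel_spec(1)[OF g] f g by (auto simp: L2sp_def)
  show "(\<lambda>x. a * f x + b * g x) \<in> L2sp lborel"
    by (intro L2sp_add L2sp_cmult f g)
  show "(\<lambda>\<xi>. a * plancherel f \<xi> + b * plancherel g \<xi>) \<in> borel_measurable borel"
    by measurable
  let ?F = "\<lambda>k \<xi>. ft (trunc_ball k f) \<xi> - plancherel f \<xi>"
  let ?G = "\<lambda>k \<xi>. ft (trunc_ball k g) \<xi> - plancherel g \<xi>"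
  let ?b = "\<lambda>k. 2 * (ennreal ((cmod a)\<^sup>2) * l2sq lborel (?F k)) + 2 * (ennreal ((cmod b)\<^sup>2) * l2sq lborel (?G k))"
  have "trunc_ball k (\<lambda>x. a * f x + b * g x) = (\<lambda>x. a * trunc_ball k f x + b * trunc_ball k g x)" for k
    by (auto simp: trunc_ball_def algebra_simps)
  then have eq: "ft (trunc_ball k (\<lambda>x. a * f x + b * g x)) \<xi> - (a * plancherel f \<xi> + b * plancherel g \<xi>)
      = a * ?F k \<xi> + b * ?G k \<xi>" for k \<xi>
    using ft_linear[OF trunc_ball_integrable[OF f] trunc_ball_integrable[OF g]]
    by (simp add: algebra_simps)
  have le: "l2sq lborel (\<lambda>\<xi>. a * ?F k \<xi> + b * ?G k \<xi>) \<le> ?b k" for k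
    using l2sq_add_le[of "\<lambda>\<xi>. a * ?F k \<xi>" lborel "\<lambda>\<xi>. b * ?G k \<xi>"] by (simp add: l2sq_cmult)
  have "?b \<longlonglongrightarrow> 2 * (ennreal ((cmod a)\<^sup>2) * 0) + 2 * (ennreal ((cmod b)\<^sup>2) * 0)"
    by (intro tendsto_add tendsto_mult_ennreal tendsto_const plancherel_spec(2) f g) auto
  then have lim: "?b \<longlonglongrightarrow> 0" by simp
  show "(\<lambda>k. l2sq lborel (\<lambda>\<xi>. ft (trunc_ball k (\<lambda>x. a * f x + b * g x)) \<xi>
      - (a * plancherel f \<xi> + b * plancherel g \<xi>))) \<longlonglongrightarrow> 0"
    unfolding eq by (rule tendsto_sandwich[OF _ _ tendsto_const lim]) (use le in simp_all)
qed

lemma tendsto_ft_trunc_ball: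
  assumes "f \<in> L2sp lborel" "g \<in> L2sp lborel"
  shows "(\<lambda>k. \<integral>\<xi>. ft (trunc_ball k f) \<xi> * g \<xi> \<partial>lborel) \<longlonglongrightarrow> (\<integral>\<xi>. plancherel f \<xi> * g \<xi> \<partial>lborel)"
  by (intro tendsto_integral_mult_L2sp ft_trunc_ball_L2sp plancherel_spec assms)

lemma tendsto_trunc_ball:
  assumes "f \<in> L2sp lborel" "g \<in> L2sp lborel"
  shows "(\<lambda>k. \<integral>x. trunc_ball k f x * g x \<partial>lborel) \<longlonglongrightarrow> (\<integral>x. f x * g x \<partial>lborel)"
  by (intro tendsto_integral_mult_L2sp trunc_ball_L2sp trunc_ball_tendsto assms)

text \<open>The limit is taken in one argument at a time, because \<open>ft_multiplication\<close>
  wants two integrable factors: first \<open>g\<close> is truncated against an integrable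
  \<open>h\<close>, then \<open>f\<close> is truncated.\<close>

lemma plancherel_multiplication:
  fixes f g :: "'a::euclidean_space \<Rightarrow> complex"
  assumes f: "f \<in> L2sp lborel" and g: "g \<in> L2sp lborel"
  shows "(\<integral>\<xi>. plancherel f \<xi> * g \<xi> \<partial>lborel) = (\<integral>x. f x * plancherel g x \<partial>lborel)"
proof -
  have int: "(\<integral>\<xi>. ft h \<xi> * g \<xi> \<partial>lborel) = (\<integral>x. h x * plancherel g x \<partial>lborel)"
    if h: "h \<in> L2sp lborel" "integrable lborel h" for h
  proof -
    have "(\<lambda>k. \<integral>\<xi>. trunc_ball k g \<xi> * ft h \<xi> \<partial>lborel) \<longlonglongrightarrow> (\<integral>\<xi>. g \<xi> * ft h \<xi> \<partial>lborel)"
      by (intro tendsto_trunc_ball g ft_L2sp h)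
    moreover have "(\<integral>\<xi>. trunc_ball k g \<xi> * ft h \<xi> \<partial>lborel) = (\<integral>x. ft (trunc_ball k g) x * h x \<partial>lborel)" for k
      by (rule ft_multiplication[OF trunc_ball_integrable[OF g] h(2), symmetric])
    moreover have "(\<lambda>k. \<integral>x. ft (trunc_ball k g) x * h x \<partial>lborel) \<longlonglongrightarrow> (\<integral>x. plancherel g x * h x \<partial>lborel)"
      by (intro tendsto_ft_trunc_ball g h)
    ultimately have "(\<integral>\<xi>. g \<xi> * ft h \<xi> \<partial>lborel) = (\<integral>x. plancherel g x * h x \<partial>lborel)"
      using LIMSEQ_unique by simp
    then show ?thesis by (simp add: mult.commute)
  qed
  have "(\<lambda>k. \<integral>\<xi>. ft (trunc_ball k f) \<xi> * g \<xi> \<partial>lborel) \<longlonglongrightarrow> (\<integral>\<xi>. plancherel f \<xi> * g \<xi> \<partial>lborel)"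
    by (rule tendsto_ft_trunc_ball[OF f g])
  moreover have "(\<integral>\<xi>. ft (trunc_ball k f) \<xi> * g \<xi> \<partial>lborel) = (\<integral>x. trunc_ball k f x * plancherel g x \<partial>lborel)" for k
    by (intro int trunc_ball_L2sp trunc_ball_integrable f)
  moreover have "(\<lambda>k. \<integral>x. trunc_ball k f x * plancherel g x \<partial>lborel) \<longlonglongrightarrow> (\<integral>x. f x * plancherel g x \<partial>lborel)"
    by (intro tendsto_trunc_ball f plancherel_spec(1) g)
  ultimately show ?thesis
    using LIMSEQ_unique by simp
qed

lemma integral_mult_cnj_self:
  "(\<integral>x. f x * cnj (f x) \<partial>M) = complex_of_real (\<integral>x. (cmod (f x))\<^sup>2 \<partial>M)"
  by (simp only: complex_norm_square[symmetric] integral_complex_of_real)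

text \<open>\<open>l2sq_triangle\<close> loses a factor 2 and cannot give the constant 1. Instead
  the truncated transforms are paired with the conjugate of their limit: Cauchy-Schwarz bounds the
  squared pairings by Q P, and the limit of the pairings is P, so P^2 \<le> Q P.\<close>

lemma l2sq_plancherel_le:
  fixes f :: "'a::euclidean_space \<Rightarrow> complex"
  assumes f: "f \<in> L2sp lborel"
  shows "l2sq lborel (plancherel f) \<le> l2sq lborel f"
proof -
  let ?w = "\<lambda>\<xi>. cnj (plancherel f \<xi>)"
  define P where "P = (\<integral>\<xi>. (cmod (plancherel f \<xi>))\<^sup>2 \<partial>lborel)"
  define Q where "Q = (\<integral>x. (cmod (f x))\<^sup>2 \<partial>lborel)"
  have PQ: "l2sq lborel (plancherel f) = ennreal P" "l2sq lborel f = ennreal Q"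
    unfolding P_def Q_def by (intro l2sq_eq_integral plancherel_spec(1) f)+
  have nn: "P \<ge> 0" "Q \<ge> 0" by (auto simp: P_def Q_def)
  have w: "?w \<in> L2sp lborel"
    by (intro L2sp_cnj plancherel_spec(1) f)
  have bound: "(cmod (\<integral>\<xi>. ft (trunc_ball k f) \<xi> * ?w \<xi> \<partial>lborel))\<^sup>2 \<le> Q * P" for k
  proof -
    have tr: "l2sq lborel (trunc_ball k f) \<le> l2sq lborel f"
      unfolding l2sq_def by (intro nn_integral_mono) (auto simp: trunc_ball_def indicator_def)
    have "ennreal ((cmod (\<integral>\<xi>. ft (trunc_ball k f) \<xi> * ?w \<xi> \<partial>lborel))\<^sup>2)
        \<le> l2sq lborel (ft (trunc_ball k f)) * l2sq lborel ?w"
      by (intro Cauchy_Schwarz_L2sp ft_trunc_ball_L2sp f w)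
    also have "\<dots> \<le> l2sq lborel f * l2sq lborel (plancherel f)"
      unfolding l2sq_cnj
      by (intro mult_right_mono order_trans[OF l2sq_ft_le tr] trunc_ball_integrable f) auto
    also have "\<dots> = ennreal (Q * P)"
      using nn by (simp add: PQ ennreal_mult)
    finally show ?thesis
      using nn by (simp add: ennreal_le_iff)
  qed
  have "(\<lambda>k. (cmod (\<integral>\<xi>. ft (trunc_ball k f) \<xi> * ?w \<xi> \<partial>lborel))\<^sup>2)
      \<longlonglongrightarrow> (cmod (\<integral>\<xi>. plancherel f \<xi> * ?w \<xi> \<partial>lborel))\<^sup>2"
    by (intro tendsto_power tendsto_norm tendsto_ft_trunc_ball f w)
  then have "(cmod (\<integral>\<xi>. plancherel f \<xi> * ?w \<xi> \<partial>lborel))\<^sup>2 \<le> Q * P"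
    by (rule LIMSEQ_le_const2) (use bound in auto)
  also have "(\<integral>\<xi>. plancherel f \<xi> * ?w \<xi> \<partial>lborel) = complex_of_real P"
    unfolding P_def by (rule integral_mult_cnj_self)
  finally have "P * P \<le> Q * P"
    by (simp add: power2_eq_square)
  then have "P \<le> Q"
    using nn by (cases "P = 0") (auto simp: mult_le_cancel_right)
  then show ?thesis
    by (simp add: PQ ennreal_leI)
qed

lemma integral_plancherel_ft:
  fixes f g :: "'a::euclidean_space \<Rightarrow> complex"
  assumes f: "f \<in> L2sp lborel" and g: "test_fun g"
  shows "(\<integral>\<xi>. plancherel f \<xi> * ft g \<xi> \<partial>lborel) = (\<integral>x. f x * g (- x) \<partial>lborel)"
proof -
  have gi: "integrable lborel g" and g2: "g \<in> L2sp lborel"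
    using g test_fun_L2sp by (auto simp: test_fun_def)
  have rg: "(\<lambda>x. g (- x)) \<in> L2sp lborel"
    using g2 l2sq_reflect[of g] by (auto simp: L2sp_def)
  have "(\<lambda>k. \<integral>\<xi>. ft (trunc_ball k f) \<xi> * ft g \<xi> \<partial>lborel) \<longlonglongrightarrow> (\<integral>\<xi>. plancherel f \<xi> * ft g \<xi> \<partial>lborel)"
    by (intro tendsto_ft_trunc_ball f ft_L2sp gi g2)
  moreover have "(\<integral>\<xi>. ft (trunc_ball k f) \<xi> * ft g \<xi> \<partial>lborel) = (\<integral>x. trunc_ball k f x * g (- x) \<partial>lborel)" for k
    by (intro integral_ft_ft trunc_ball_integrable trunc_ball_L2sp f g)
  moreover have "(\<lambda>k. \<integral>x. trunc_ball k f x * g (- x) \<partial>lborel) \<longlonglongrightarrow> (\<integral>x. f x * g (- x) \<partial>lborel)"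
    by (intro tendsto_trunc_ball f rg)
  ultimately show ?thesis
    using LIMSEQ_unique by simp
qed

text \<open>Tested against \<open>g\<close>, the multiplication formula moves one transform onto
  \<open>g\<close>, where it is a genuine Fourier integral and \<open>integral_plancherel_ft\<close>
  applies. The closing substitution moves the reflection from \<open>g\<close> to
  \<open>f\<close>.\<close>

theorem plancherel_plancherel:
  fixes f :: "'a::euclidean_space \<Rightarrow> complex"
  assumes f: "f \<in> L2sp lborel"
  shows "AE x in lborel. plancherel (plancherel f) x = f (- x)"
proof -
  have [measurable]: "f \<in> borel_measurable borel" using f by (simp add: L2sp_def)
  have rf: "(\<lambda>x. f (- x)) \<in> L2sp lborel"
    using f l2sq_reflect[of f] by (auto simp: L2sp_def)
  have pf: "plancherel f \<in> L2sp lborel" and ppf: "plancherel (plancherel f) \<in> L2sp lborel"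
    by (intro plancherel_spec(1) f)+
  have "AE x in lborel. plancherel (plancherel f) x - f (- x) = 0"
  proof (rule AE_zero_if_test_integral_zero[OF L2sp_diff[OF ppf rf]])
    fix g :: "'a \<Rightarrow> complex" assume g: "test_fun g"
    then have gi: "integrable lborel g" and g2: "g \<in> L2sp lborel"
      using test_fun_L2sp by (auto simp: test_fun_def)
    have [measurable]: "g \<in> borel_measurable borel" using g2 by (simp add: L2sp_def)
    have [measurable]: "plancherel f \<in> borel_measurable borel" "plancherel g \<in> borel_measurable borel"
      using pf plancherel_spec(1)[OF g2] by (auto simp: L2sp_def)
    have "(\<integral>x. plancherel (plancherel f) x * g x \<partial>lborel) = (\<integral>\<xi>. plancherel f \<xi> * plancherel g \<xi> \<partial>lborel)"
      by (rule plancherel_multiplication[OF pf g2])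
    also have "\<dots> = (\<integral>\<xi>. plancherel f \<xi> * ft g \<xi> \<partial>lborel)"
      using plancherel_eq_ft[OF g2 gi] by (intro integral_cong_AE) auto
    also have "\<dots> = (\<integral>x. f x * g (- x) \<partial>lborel)"
      by (rule integral_plancherel_ft[OF f g])
    also have "\<dots> = (\<bar>-1\<bar> ^ DIM('a)) *\<^sub>R (\<integral>x. f (0 + (-1) *\<^sub>R x) * g (- (0 + (-1) *\<^sub>R x)) \<partial>lborel)"
      by (rule lborel_integral_affine) auto
    also have "\<dots> = (\<integral>x. f (- x) * g x \<partial>lborel)"
      by simp
    finally show "(\<integral>x. (plancherel (plancherel f) x - f (- x)) * g x \<partial>lborel) = 0"
      using integrable_L2sp_mult[OF ppf g2] integrable_L2sp_mult[OF rf g2]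
      by (simp add: left_diff_distrib)
  qed
  then show ?thesis by simp
qed

theorem l2sq_plancherel:
  fixes f :: "'a::euclidean_space \<Rightarrow> complex"
  assumes f: "f \<in> L2sp lborel"
  shows "l2sq lborel (plancherel f) = l2sq lborel f"
proof (rule antisym)
  show "l2sq lborel (plancherel f) \<le> l2sq lborel f"
    by (rule l2sq_plancherel_le[OF f])
  have "l2sq lborel f = l2sq lborel (\<lambda>x. f (- x))"
    using f by (intro l2sq_reflect[symmetric]) (simp add: L2sp_def)
  also have "\<dots> = l2sq lborel (plancherel (plancherel f))"
    using plancherel_plancherel[OF f] by (intro l2sq_cong_AE) auto
  also have "\<dots> \<le> l2sq lborel (plancherel f)"
    by (intro l2sq_plancherel_le plancherel_spec(1) f)
  finally show "l2sq lborel f \<le> l2sq lborel (plancherel f)" .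
qed

lemma polarization_L2sp:
  assumes f: "f \<in> L2sp M" and g: "g \<in> L2sp M"
  shows "(\<integral>x. (cmod (f x + c * g x))\<^sup>2 \<partial>M) = (\<integral>x. (cmod (f x))\<^sup>2 \<partial>M)
    + (cmod c)\<^sup>2 * (\<integral>x. (cmod (g x))\<^sup>2 \<partial>M) + 2 * Re (cnj c * (\<integral>x. f x * cnj (g x) \<partial>M))"
proof -
  have int: "integrable M (\<lambda>x. f x * cnj (g x))"
    by (intro integrable_L2sp_mult f L2sp_cnj g)
  \<comment> \<open>Checked in the complex numbers, where |z|^2 becomes z times its conjugate and
    the claim is ring arithmetic.\<close>
  have "complex_of_real ((cmod (f x + c * g x))\<^sup>2) = complex_of_real ((cmod (f x))\<^sup>2 + (cmod c)\<^sup>2 * (cmod (g x))\<^sup>2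
      + 2 * Re (cnj c * (f x * cnj (g x))))" for x
  proof -
    have "complex_of_real (2 * Re (cnj c * (f x * cnj (g x))))
        = cnj c * (f x * cnj (g x)) + cnj (cnj c * (f x * cnj (g x)))"
      by (simp only: complex_add_cnj)
    then show ?thesis
      unfolding of_real_add of_real_mult[of "(cmod c)\<^sup>2"] complex_norm_square
      by (simp add: algebra_simps)
  qed
  then have eq: "(cmod (f x + c * g x))\<^sup>2 = (cmod (f x))\<^sup>2 + (cmod c)\<^sup>2 * (cmod (g x))\<^sup>2
      + 2 * Re (cnj c * (f x * cnj (g x)))" for x
    by (simp only: of_real_eq_iff)
  define R where "R x = Re (cnj c * (f x * cnj (g x)))" for x
  have int': "integrable M (\<lambda>x. cnj c * (f x * cnj (g x)))"
    using int by (rule integrable_mult_right)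
  have "(\<integral>x. R x \<partial>M) = Re (cnj c * (\<integral>x. f x * cnj (g x) \<partial>M))"
    unfolding R_def integral_Re[OF int'] by (simp only: integral_mult_right_zero)
  moreover have "integrable M R"
    unfolding R_def using int' by (rule integrable_Re)
  ultimately show ?thesis
    using f g unfolding eq R_def[symmetric] by (simp add: L2sp_iff_integrable)
qed

text \<open>Polarisation: linearity and equality of norms for f + c g leave only the mixed term to
  compare.\<close>

theorem plancherel_inner:
  fixes f g :: "'a::euclidean_space \<Rightarrow> complex"
  assumes f: "f \<in> L2sp lborel" and g: "g \<in> L2sp lborel"
  shows "(\<integral>\<xi>. plancherel f \<xi> * cnj (plancherel g \<xi>) \<partial>lborel) = (\<integral>x. f x * cnj (g x) \<partial>lborel)"
proof -
  have iso: "(\<integral>\<xi>. (cmod (plancherel h \<xi>))\<^sup>2 \<partial>lborel) = (\<integral>x. (cmod (h x))\<^sup>2 \<partial>lborel)"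
    if h: "h \<in> L2sp lborel" for h :: "'a \<Rightarrow> complex"
    using l2sq_plancherel[OF h] unfolding l2sq_eq_integral[OF h] l2sq_eq_integral[OF plancherel_spec(1)[OF h]]
    by (subst (asm) ennreal_inj) auto
  have pf: "plancherel f \<in> L2sp lborel" "plancherel g \<in> L2sp lborel"
    by (intro plancherel_spec(1) f g)+
  have key: "Re (cnj c * (\<integral>\<xi>. plancherel f \<xi> * cnj (plancherel g \<xi>) \<partial>lborel))
      = Re (cnj c * (\<integral>x. f x * cnj (g x) \<partial>lborel))" for c
  proof -
    have h: "(\<lambda>x. f x + c * g x) \<in> L2sp lborel"
      by (intro L2sp_add L2sp_cmult f g)
    have ae: "AE \<xi> in lborel. plancherel (\<lambda>x. f x + c * g x) \<xi> = plancherel f \<xi> + c * plancherel g \<xi>"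
      using plancherel_linear[OF f g, of 1 c] by simp
    have "(\<integral>\<xi>. (cmod (plancherel f \<xi> + c * plancherel g \<xi>))\<^sup>2 \<partial>lborel)
        = (\<integral>\<xi>. (cmod (plancherel (\<lambda>x. f x + c * g x) \<xi>))\<^sup>2 \<partial>lborel)"
      using ae pf plancherel_spec(1)[OF h] by (intro integral_cong_AE) (auto simp: L2sp_def)
    also have "\<dots> = (\<integral>x. (cmod (f x + c * g x))\<^sup>2 \<partial>lborel)"
      by (rule iso[OF h])
    finally show ?thesis
      unfolding polarization_L2sp[OF f g] polarization_L2sp[OF pf] iso[OF f] iso[OF g] by simp
  qed
  \<comment> \<open>\<open>c = 1\<close> compares real parts and \<open>c = \<i>\<close> imaginary
    parts, since Re (cnj \<i> * z) = Im z.\<close>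
  show ?thesis
    using key[of 1] key[of \<i>] by (intro complex_eqI) auto
qed

text \<open>The reflection produced by applying the transform twice is undone in advance by
  reflecting \<open>h\<close>.\<close>

theorem plancherel_surj:
  fixes h :: "'a::euclidean_space \<Rightarrow> complex"
  assumes h: "h \<in> L2sp lborel"
  shows "\<exists>f \<in> L2sp lborel. AE \<xi> in lborel. plancherel f \<xi> = h \<xi>"
proof
  have "h \<in> borel_measurable borel" using h by (simp add: L2sp_def)
  then have rh: "(\<lambda>x. h (- x)) \<in> L2sp lborel"
    using h l2sq_reflect[of h] by (auto simp: L2sp_def)
  then show "plancherel (\<lambda>x. h (- x)) \<in> L2sp lborel"
    by (rule plancherel_spec(1))
  show "AE \<xi> in lborel. plancherel (plancherel (\<lambda>x. h (- x))) \<xi> = h \<xi>"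
    using plancherel_plancherel[OF rh] by simp
qed

section \<open>Change of variables\<close>

text \<open>
  The change-of-variables theorems of HOL-Analysis need a well-ordered index type; \<open>'n wo\<close> is a copy
  of the finite type \<open>'n\<close> with an arbitrary order.
\<close>

typedef 'n wo = "UNIV :: 'n set" by simp

lemma bij_Rep_wo: "bij Rep_wo"
  by (metis Abs_wo_inverse Rep_wo_inverse UNIV_I bij_iff)

instance wo :: (finite) finite
proof
  have "finite (range (Abs_wo :: 'a \<Rightarrow> 'a wo))" by simp
  moreover have "range (Abs_wo :: 'a \<Rightarrow> 'a wo) = UNIV"
    by (metis Rep_wo_inverse surjI)
  ultimately show "finite (UNIV :: 'a wo set)" by simp
qed

text \<open>The order is pulled back along the injection \<open>to_nat\<close> of a countable type,
  so well-foundedness is induction on a natural-number measure.\<close>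

instantiation wo :: (finite) wellorder
begin

definition less_eq_wo :: "'a wo \<Rightarrow> 'a wo \<Rightarrow> bool" where
  "a \<le> b \<longleftrightarrow> to_nat (Rep_wo a) \<le> to_nat (Rep_wo b)"

definition less_wo :: "'a wo \<Rightarrow> 'a wo \<Rightarrow> bool" where
  "a < b \<longleftrightarrow> to_nat (Rep_wo a) < to_nat (Rep_wo b)"

instance
proof
  fix a b c :: "'a wo"
  show "a \<le> b \<Longrightarrow> b \<le> a \<Longrightarrow> a = b"
    by (simp add: less_eq_wo_def Rep_wo_inject)
  fix P :: "'a wo \<Rightarrow> bool"
  assume step: "\<And>x. (\<And>y. y < x \<Longrightarrow> P y) \<Longrightarrow> P x"
  show "P a"
    using step unfolding less_wo_def by (rule measure_induct_rule[of "\<lambda>a. to_nat (Rep_wo a)"])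
qed (auto simp: less_eq_wo_def less_wo_def)

end

section \<open>Relabelling coordinates\<close>

definition to_wo :: "real ^ 'n \<Rightarrow> real ^ 'n wo" where
  "to_wo x = (\<chi> i. x $ Rep_wo i)"

definition of_wo :: "real ^ 'n wo \<Rightarrow> real ^ 'n" where
  "of_wo y = (\<chi> i. y $ Abs_wo i)"

lemma of_wo_to_wo [simp]: "of_wo (to_wo x) = x"
  by (simp add: of_wo_def to_wo_def vec_eq_iff Abs_wo_inverse)

lemma to_wo_of_wo [simp]: "to_wo (of_wo y) = y"
  by (simp add: of_wo_def to_wo_def vec_eq_iff Rep_wo_inverse)

lemma bounded_linear_to_wo: "bounded_linear to_wo"
  by (intro linear_conv_bounded_linear[THEN iffD1] linearI) (auto simp: to_wo_def vec_eq_iff)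

lemma bounded_linear_of_wo: "bounded_linear of_wo"
  by (intro linear_conv_bounded_linear[THEN iffD1] linearI) (auto simp: of_wo_def vec_eq_iff)

lemma measurable_to_wo [measurable]: "to_wo \<in> borel_measurable borel"
  by (intro borel_measurable_continuous_onI linear_continuous_on bounded_linear_to_wo)

lemma measurable_of_wo [measurable]: "of_wo \<in> borel_measurable borel"
  by (intro borel_measurable_continuous_onI linear_continuous_on bounded_linear_of_wo)

lemma prod_Basis_cart: "(\<Prod>b\<in>Basis. (x :: real ^ 'n) \<bullet> b) = (\<Prod>i\<in>UNIV. x $ i)"
proof -
  have B: "Basis = range (\<lambda>i::'n. axis i (1::real))"
    by (auto simp: Basis_vec_def)
  have inj: "inj (\<lambda>i::'n. axis i (1::real))"
    by (auto simp: inj_def axis_eq_axis)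
  show ?thesis
    unfolding B prod.reindex[OF inj] by (simp add: inner_axis)
qed

text \<open>Relabelling maps boxes to boxes with the same side lengths in another order, and values
  on boxes determine \<open>lborel\<close>.\<close>

lemma distr_of_wo: "distr lborel borel (of_wo :: real ^ 'n wo \<Rightarrow> real ^ 'n) = lborel"
proof (rule lborel_eqI[symmetric])
  fix l u :: "real ^ 'n"
  assume le: "\<And>b. b \<in> Basis \<Longrightarrow> l \<bullet> b \<le> u \<bullet> b"
  have li: "l $ i \<le> u $ i" for i
    using le[of "axis i 1"] by (simp add: inner_axis)
  have "of_wo -` box l u = box (to_wo l) (to_wo u)"
  proof (intro set_eqI iffI)
    fix y :: "real ^ 'n wo"
    show "y \<in> of_wo -` box l u \<Longrightarrow> y \<in> box (to_wo l) (to_wo u)"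
      by (auto simp: mem_box_cart of_wo_def to_wo_def) (metis Rep_wo_inverse)+
    show "y \<in> box (to_wo l) (to_wo u) \<Longrightarrow> y \<in> of_wo -` box l u"
      by (auto simp: mem_box_cart of_wo_def to_wo_def) (metis Abs_wo_inverse UNIV_I)+
  qed
  then have "emeasure (distr lborel borel of_wo) (box l u) = emeasure lborel (box (to_wo l) (to_wo u))"
    by (simp add: emeasure_distr)
  also have "\<dots> = ennreal (\<Prod>b\<in>Basis. (to_wo u - to_wo l) \<bullet> b)"
    by (rule emeasure_lborel_box) (auto simp: Basis_vec_def inner_axis to_wo_def li)
  also have "(\<Prod>b\<in>Basis. (to_wo u - to_wo l) \<bullet> b) = (\<Prod>i\<in>UNIV. (u - l) $ Rep_wo i)"
    by (simp add: prod_Basis_cart to_wo_def)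
  also have "\<dots> = (\<Prod>i\<in>UNIV. (u - l) $ i)"
    using bij_Rep_wo by (intro prod.reindex_bij_betw)
  also have "\<dots> = (\<Prod>b\<in>Basis. (u - l) \<bullet> b)"
    by (simp only: prod_Basis_cart)
  finally show "emeasure (distr lborel borel of_wo) (box l u) = ennreal (\<Prod>b\<in>Basis. (u - l) \<bullet> b)" .
qed simp

text \<open>Conjugation by \<open>f\<close> is a sign-preserving bijection between the permutations
  of the two index types, so the Leibniz sums agree term by term.\<close>

lemma det_reindex:
  fixes A :: "'a::comm_ring_1 ^ 'n ^ 'n" and f :: "'m::finite \<Rightarrow> 'n"
  assumes f: "bij f"
  shows "det (\<chi> i j. A $ f i $ f j) = det A"
proof -
  have sgn: "sign (f \<circ> p \<circ> inv f) = sign p" if "p permutes UNIV" for p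
  proof -
    have "map_permutation UNIV f p = f \<circ> p \<circ> inv f"
      using f by (simp add: map_permutation_def restrict_id_def bij_is_surj fun_eq_iff)
    then show ?thesis
      using sign_map_permutation[of f UNIV p] that f by (simp add: bij_is_inj)
  qed
  have inv: "inv f (f x) = x" "f (inv f y) = y" for x y
    using f by (simp_all add: bij_is_inj bij_is_surj surj_f_inv_f)
  show ?thesis
    unfolding det_def
  proof (rule sum.reindex_bij_witness[of _ "\<lambda>q. inv f \<circ> q \<circ> f" "\<lambda>p. f \<circ> p \<circ> inv f"])
    fix p :: "'m \<Rightarrow> 'm" assume p: "p \<in> {p. p permutes UNIV}"
    then have bp: "bij p" by (simp add: permutes_bij)
    show "inv f \<circ> (f \<circ> p \<circ> inv f) \<circ> f = p" by (auto simp: inv)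
    show "f \<circ> p \<circ> inv f \<in> {p. p permutes UNIV}"
      using bp f by (auto intro!: bij_imp_permutes bij_comp bij_imp_bij_inv)
    have "(\<Prod>i\<in>UNIV. A $ i $ (f \<circ> p \<circ> inv f) i) = (\<Prod>i\<in>UNIV. A $ f i $ (f \<circ> p \<circ> inv f) (f i))"
      using f by (intro prod.reindex_bij_betw[symmetric])
    then show "of_int (sign (f \<circ> p \<circ> inv f)) * (\<Prod>i\<in>UNIV. A $ i $ (f \<circ> p \<circ> inv f) i)
        = of_int (sign p) * (\<Prod>i\<in>UNIV. (\<chi> i j. A $ f i $ f j) $ i $ p i)"
      using p by (simp add: sgn inv)
  next
    fix q :: "'n \<Rightarrow> 'n" assume q: "q \<in> {p. p permutes UNIV}"
    then have "bij q" by (simp add: permutes_bij)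
    then show "inv f \<circ> q \<circ> f \<in> {p. p permutes UNIV}"
      using f by (auto intro!: bij_imp_permutes bij_comp bij_imp_bij_inv)
    show "f \<circ> (inv f \<circ> q \<circ> f) \<circ> inv f = q" by (auto simp: inv)
  qed
qed

text \<open>\<open>has_measure_differentiable_image\<close> is read backwards: the image of the
  preimage is the box itself, whose measure is known, and this yields the integral of the Jacobian
  over the preimage.\<close>

lemma emeasure_box_change_of_variables:
  fixes \<psi> :: "real ^ 'm::{finite,wellorder} \<Rightarrow> real ^ 'm::_"
  assumes bij: "bij \<psi>" and der: "\<And>x. (\<psi> has_derivative \<psi>' x) (at x)"
  shows "emeasure lborel (box l u)
    = (\<integral>\<^sup>+x. indicator (\<psi> -` box l u) x * ennreal \<bar>det (matrix (\<psi>' x))\<bar> \<partial>lborel)"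
proof -
  let ?S = "\<psi> -` box l u"
  have cont: "continuous_on UNIV \<psi>"
    by (meson der has_derivative_continuous continuous_at_imp_continuous_on)
  have "open ?S"
    using cont by (intro open_vimage open_box) auto
  then have S: "?S \<in> sets lebesgue" by simp
  have img: "\<psi> ` ?S = box l u"
    using bij by (simp add: bij_is_surj surj_image_vimage_eq)
  have "\<psi> ` ?S \<in> lmeasurable \<and> measure lebesgue (\<psi> ` ?S) = measure lebesgue (box l u)"
    unfolding img by simp
  then have "((\<lambda>x. \<bar>det (matrix (\<psi>' x))\<bar>) has_integral measure lebesgue (box l u)) ?S"
    using bij by (subst (asm) has_measure_differentiable_image[OF S])
      (auto intro: has_derivative_at_withinI[OF der] inj_on_subset[OF bij_is_inj])
  from nn_integral_has_integral_lebesgue[OF _ this]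
  have "(\<integral>\<^sup>+x. ennreal (indicator ?S x * \<bar>det (matrix (\<psi>' x))\<bar>) \<partial>lborel) = ennreal (measure lebesgue (box l u))"
    by simp
  also have "\<dots> = emeasure lborel (box l u)"
    using emeasure_lborel_box_finite[of l u] by (subst emeasure_eq_ennreal_measure) auto
  finally show ?thesis
    by (simp add: ennreal_mult' ennreal_indicator)
qed

text \<open>As an identity of measures, the change of variables only has to be checked on boxes.
  These are carried over to the index type \<open>'n wo\<close>, where \<open>det_reindex\<close>
  shows that the Jacobian is the same.\<close>

theorem distr_density_det:
  fixes \<phi> :: "real ^ 'n \<Rightarrow> real ^ 'n"
  assumes bij: "bij \<phi>" and der: "\<And>x. (\<phi> has_derivative \<phi>' x) (at x)"
    and meas: "(\<lambda>x. det (matrix (\<phi>' x))) \<in> borel_measurable borel"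
  shows "distr (density lborel (\<lambda>x. ennreal \<bar>det (matrix (\<phi>' x))\<bar>)) borel \<phi> = lborel"
proof (rule lborel_eqI[symmetric])
  note [measurable] = meas
  define \<psi> where "\<psi> = to_wo \<circ> \<phi> \<circ> of_wo"
  define \<psi>' where "\<psi>' y = to_wo \<circ> \<phi>' (of_wo y) \<circ> of_wo" for y
  have "continuous_on UNIV \<phi>"
    by (meson der has_derivative_continuous continuous_at_imp_continuous_on)
  then have [measurable]: "\<phi> \<in> borel_measurable borel"
    by (rule borel_measurable_continuous_onI)
  have "bij (to_wo :: real ^ 'n \<Rightarrow> _)" "bij (of_wo :: _ \<Rightarrow> real ^ 'n)"
    by (metis of_wo_to_wo to_wo_of_wo bij_iff)+
  then have bij': "bij \<psi>"
    unfolding \<psi>_def using bij by (intro bij_comp)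
  have der': "(\<psi> has_derivative \<psi>' y) (at y)" for y
    unfolding \<psi>_def \<psi>'_def comp_assoc
    by (intro diff_chain_at bounded_linear_imp_has_derivative bounded_linear_to_wo bounded_linear_of_wo)
       (simp add: der)
  have ax: "of_wo (axis j 1) = axis (Rep_wo j) (1::real)" for j :: "'n wo"
    by (auto simp: of_wo_def axis_def vec_eq_iff Abs_wo_inverse Rep_wo_inverse)
  have "matrix (\<psi>' y) = (\<chi> i j. matrix (\<phi>' (of_wo y)) $ Rep_wo i $ Rep_wo j)" for y
    unfolding vec_eq_iff by (simp add: matrix_def \<psi>'_def to_wo_def ax)
  then have det: "det (matrix (\<psi>' y)) = det (matrix (\<phi>' (of_wo y)))" for y
    by (simp add: det_reindex[OF bij_Rep_wo])
  fix l u :: "real ^ 'n"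
  assume le: "\<And>b. b \<in> Basis \<Longrightarrow> l \<bullet> b \<le> u \<bullet> b"
  have box: "x \<in> box l u \<longleftrightarrow> to_wo x \<in> box (to_wo l) (to_wo u)" for x
    by (auto simp: mem_box_cart to_wo_def) (metis Abs_wo_inverse UNIV_I)+
  have vim [measurable]: "\<phi> -` box l u \<in> sets borel"
    using measurable_sets[of \<phi> borel borel "box l u"] by simp
  have "emeasure (distr (density lborel (\<lambda>x. ennreal \<bar>det (matrix (\<phi>' x))\<bar>)) borel \<phi>) (box l u)
      = (\<integral>\<^sup>+x. indicator (\<phi> -` box l u) x * ennreal \<bar>det (matrix (\<phi>' x))\<bar> \<partial>lborel)"
    by (simp add: emeasure_distr emeasure_density vim mult.commute)
  also have "\<dots> = (\<integral>\<^sup>+x. indicator (\<phi> -` box l u) x * ennreal \<bar>det (matrix (\<phi>' x))\<bar> \<partial>distr lborel borel of_wo)"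
    by (simp add: distr_of_wo)
  also have "\<dots> = (\<integral>\<^sup>+y. indicator (\<phi> -` box l u) (of_wo y) * ennreal \<bar>det (matrix (\<phi>' (of_wo y)))\<bar> \<partial>lborel)"
    by (rule nn_integral_distr) measurable
  also have "\<dots> = (\<integral>\<^sup>+y. indicator (\<psi> -` box (to_wo l) (to_wo u)) y * ennreal \<bar>det (matrix (\<psi>' y))\<bar> \<partial>lborel)"
    by (simp add: det indicator_def \<psi>_def box)
  also have "\<dots> = emeasure lborel (box (to_wo l) (to_wo u))"
    by (rule emeasure_box_change_of_variables[OF bij' der', symmetric])
  also have "\<dots> = emeasure (distr lborel borel of_wo) (box l u)"
    by (subst emeasure_distr) (auto simp: vimage_def box)
  also have "\<dots> = ennreal (\<Prod>b\<in>Basis. (u - l) \<bullet> b)"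
    using le by (simp add: distr_of_wo emeasure_lborel_box)
  finally show "emeasure (distr (density lborel (\<lambda>x. ennreal \<bar>det (matrix (\<phi>' x))\<bar>)) borel \<phi>) (box l u)
      = ennreal (\<Prod>b\<in>Basis. (u - l) \<bullet> b)" .
qed simp

section \<open>The weighted Fourier transform\<close>

lemma ex_borel_version:
  fixes f :: "'a::euclidean_space \<Rightarrow> complex"
  assumes [measurable]: "f \<in> borel_measurable lebesgue"
  shows "\<exists>f'. f' \<in> borel_measurable borel \<and> (AE x in lborel. f x = f' x)"
proof -
  have "(\<lambda>x. Re (f x)) \<in> borel_measurable lebesgue"
    by measurable
  from completion_ex_borel_measurable_real[OF this] obtain r
    where [measurable]: "r \<in> borel_measurable borel" and r: "AE x in lborel. Re (f x) = r x"
    by auto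
  have "(\<lambda>x. Im (f x)) \<in> borel_measurable lebesgue"
    by measurable
  from completion_ex_borel_measurable_real[OF this] obtain i
    where [measurable]: "i \<in> borel_measurable borel" and i: "AE x in lborel. Im (f x) = i x"
    by auto
  have "(\<lambda>x. complex_of_real (r x) + \<i> * complex_of_real (i x)) \<in> borel_measurable borel"
    by measurable
  moreover have "AE x in lborel. f x = complex_of_real (r x) + \<i> * complex_of_real (i x)"
    using r i by eventually_elim (simp add: complex_eq_iff)
  ultimately show ?thesis by blast
qed

text \<open>Composition with the inverse of \<phi> and Fubini for \<open>lborel\<close> call for
  Borel functions, while the weighted spaces consist of Lebesgue measurable ones.
  \<open>unitary_fourier_cong_AE\<close> shows that the choice made by \<open>SOME\<close> does not
  matter.\<close>

definition borel_version :: "('a::euclidean_space \<Rightarrow> complex) \<Rightarrow> 'a \<Rightarrow> complex" where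
  "borel_version f = (SOME f'. f' \<in> borel_measurable borel \<and> (AE x in lborel. f x = f' x))"

lemma borel_version:
  assumes "f \<in> borel_measurable lebesgue"
  shows "borel_version f \<in> borel_measurable borel" and "AE x in lborel. f x = borel_version f x"
  using someI_ex[OF ex_borel_version[OF assms]] by (auto simp: borel_version_def)

lemma borel_imp_lebesgue_measurable: "f \<in> borel_measurable borel \<Longrightarrow> f \<in> borel_measurable lebesgue"
  by (simp add: measurable_completion)

lemma lebesgue_integral_AE_borel:
  fixes F :: "'a::euclidean_space \<Rightarrow> 'b::{banach, second_countable_topology}"
  assumes F: "F \<in> borel_measurable lebesgue" and G: "G \<in> borel_measurable borel"
    and ae: "AE x in lborel. F x = G x"
  shows "integrable lebesgue F \<longleftrightarrow> integrable lborel G"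
    and "integral\<^sup>L lebesgue F = integral\<^sup>L lborel G"
proof -
  have ae': "AE x in lebesgue. F x = G x"
    using ae by (rule AE_completion)
  have G': "G \<in> borel_measurable lborel" using G by simp
  have "integrable lebesgue F \<longleftrightarrow> integrable lebesgue G"
    by (rule integrable_cong_AE[OF F borel_imp_lebesgue_measurable[OF G] ae'])
  then show "integrable lebesgue F \<longleftrightarrow> integrable lborel G"
    by (simp add: integrable_completion[OF G'])
  have "integral\<^sup>L lebesgue F = integral\<^sup>L lebesgue G"
    by (rule integral_cong_AE[OF F borel_imp_lebesgue_measurable[OF G] ae'])
  then show "integral\<^sup>L lebesgue F = integral\<^sup>L lborel G"
    by (simp add: integral_completion[OF G'])
qed

section \<open>Regularity of smooth maps and their Jacobians\<close>

lemma smooth_map_continuous: "smooth_map f \<Longrightarrow> continuous_on UNIV f"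
  unfolding smooth_map_def by (metis C_k_map.simps(1))

lemma smooth_map_differentiable: "smooth_map f \<Longrightarrow> f differentiable (at x)"
  unfolding smooth_map_def by (metis C_k_map.simps(2))

lemma smooth_map_continuous_derivative:
  "smooth_map f \<Longrightarrow> continuous_on UNIV (\<lambda>x. frechet_derivative f (at x) v)"
  unfolding smooth_map_def by (metis C_k_map.simps)

text \<open>The determinant is a polynomial in its entries, and each entry is a coordinate of the
  derivative in a fixed direction, which \<open>smooth_map\<close> makes continuous.\<close>

lemma continuous_jacobian_det:
  fixes \<phi> :: "real ^ 'n \<Rightarrow> real ^ 'n"
  assumes "smooth_map \<phi>"
  shows "continuous_on UNIV (jacobian_det \<phi>)"
  unfolding jacobian_det_def[abs_def] jacobian_def det_def matrix_def
  by (auto intro!: continuous_intros smooth_map_continuous_derivative assms)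

section \<open>Transport to the unweighted space and the unitary operator\<close>

locale weighted_diffeo =
  fixes \<phi> :: "real ^ 'n \<Rightarrow> real ^ 'n" and \<omega> :: "real ^ 'n \<Rightarrow> complex"
  assumes diffeo: "smooth_diffeo \<phi>"
    and jacobian_nonzero: "\<And>x. jacobian_det \<phi> x \<noteq> 0"
    and omega_smooth: "smooth_map \<omega>"
    and omega_nonzero: "\<And>x. \<omega> x \<noteq> 0"
begin

abbreviation "J x \<equiv> \<bar>jacobian_det \<phi> x\<bar>"
abbreviation "\<psi> \<equiv> inv \<phi>"

lemma inv_simps [simp]: "\<psi> (\<phi> x) = x" "\<phi> (\<psi> y) = y"
  using diffeo by (auto simp: smooth_diffeo_def bij_is_inj bij_is_surj surj_f_inv_f)

lemma measurable_phi [measurable]: "\<phi> \<in> borel_measurable borel"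
  using diffeo by (intro borel_measurable_continuous_onI smooth_map_continuous) (simp add: smooth_diffeo_def)

lemma measurable_psi [measurable]: "\<psi> \<in> borel_measurable borel"
  using diffeo by (intro borel_measurable_continuous_onI smooth_map_continuous) (simp add: smooth_diffeo_def)

lemma measurable_omega [measurable]: "\<omega> \<in> borel_measurable borel"
  by (intro borel_measurable_continuous_onI smooth_map_continuous omega_smooth)

lemma measurable_jacobian [measurable]: "jacobian_det \<phi> \<in> borel_measurable borel"
  using diffeo by (intro borel_measurable_continuous_onI continuous_jacobian_det) (simp add: smooth_diffeo_def)

lemma measurable_weight2 [measurable]: "weight2 \<phi> \<omega> \<in> borel_measurable borel"
  unfolding weight2_def[abs_def] by measurable

text \<open>Integrals and null sets are both transferred through this one identity of
  measures.\<close>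

lemma distr_phi: "distr (density lborel (\<lambda>x. ennreal (J x))) borel \<phi> = lborel"
proof -
  have "(\<phi> has_derivative frechet_derivative \<phi> (at x)) (at x)" for x
    using diffeo smooth_map_differentiable[of \<phi> x] by (simp add: smooth_diffeo_def frechet_derivative_works)
  moreover have "jacobian_det \<phi> = (\<lambda>x. det (matrix (frechet_derivative \<phi> (at x))))"
    by (simp add: jacobian_det_def[abs_def] jacobian_def)
  ultimately show ?thesis
    using distr_density_det[of \<phi> "\<lambda>x. frechet_derivative \<phi> (at x)"] diffeo measurable_jacobian
    by (simp add: smooth_diffeo_def)
qed

lemma integral_phi:
  fixes h :: "real ^ 'n \<Rightarrow> 'b::{banach, second_countable_topology}"
  assumes [measurable]: "h \<in> borel_measurable borel"
  shows "integrable lborel h \<longleftrightarrow> integrable lborel (\<lambda>x. J x *\<^sub>R h (\<phi> x))"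
    and "integral\<^sup>L lborel h = (\<integral>x. J x *\<^sub>R h (\<phi> x) \<partial>lborel)"
proof -
  have "integrable lborel h \<longleftrightarrow> integrable (distr (density lborel (\<lambda>x. ennreal (J x))) borel \<phi>) h"
    by (simp add: distr_phi)
  also have "\<dots> \<longleftrightarrow> integrable lborel (\<lambda>x. J x *\<^sub>R h (\<phi> x))"
    by (simp add: integrable_distr_eq integrable_density)
  finally show "integrable lborel h \<longleftrightarrow> integrable lborel (\<lambda>x. J x *\<^sub>R h (\<phi> x))" .
  have "integral\<^sup>L lborel h = integral\<^sup>L (distr (density lborel (\<lambda>x. ennreal (J x))) borel \<phi>) h"
    by (simp add: distr_phi)
  also have "\<dots> = (\<integral>x. J x *\<^sub>R h (\<phi> x) \<partial>lborel)"
    by (simp add: integral_distr integral_density)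
  finally show "integral\<^sup>L lborel h = (\<integral>x. J x *\<^sub>R h (\<phi> x) \<partial>lborel)" .
qed

definition transport :: "(real ^ 'n \<Rightarrow> complex) \<Rightarrow> real ^ 'n \<Rightarrow> complex" where
  "transport f y = \<omega> (\<psi> y) * f (\<psi> y)"

lemma measurable_transport [measurable]:
  "f \<in> borel_measurable borel \<Longrightarrow> transport f \<in> borel_measurable borel"
  unfolding transport_def[abs_def]
  by (intro borel_measurable_times measurable_compose[OF measurable_psi]) auto

lemma transport_cong_AE:
  assumes [measurable]: "f \<in> borel_measurable borel" "g \<in> borel_measurable borel"
    and ae: "AE x in lborel. f x = g x"
  shows "AE y in lborel. transport f y = transport g y"
proof -
  have "AE y in distr (density lborel (\<lambda>x. ennreal (J x))) borel \<phi>. transport f y = transport g y"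
    using ae by (subst AE_distr_iff) (auto simp: AE_density transport_def)
  then show ?thesis unfolding distr_phi .
qed

text \<open>In the weight |\<omega>|^2 J the first factor comes from \<open>transport\<close> and J
  from the substitution. The forward direction is what places the preimage in the weighted space in
  \<open>unitary_fourier_surj\<close>.\<close>

lemma transport_L2sp_iff:
  assumes f: "f \<in> borel_measurable lebesgue"
  shows "transport (borel_version f) \<in> L2sp lborel \<longleftrightarrow> f \<in> L2_\<phi>\<omega> \<phi> \<omega>"
proof -
  note bv [measurable] = borel_version(1)[OF f]
  have "transport (borel_version f) \<in> L2sp lborel
      \<longleftrightarrow> integrable lborel (\<lambda>y. (cmod (transport (borel_version f) y))\<^sup>2)"
    by (simp add: L2sp_iff_integrable)
  also have "\<dots> \<longleftrightarrow> integrable lborel (\<lambda>x. J x *\<^sub>R (cmod (transport (borel_version f) (\<phi> x)))\<^sup>2)"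
    by (rule integral_phi(1)) measurable
  also have "(\<lambda>x. J x *\<^sub>R (cmod (transport (borel_version f) (\<phi> x)))\<^sup>2)
      = (\<lambda>x. (cmod (borel_version f x))\<^sup>2 * weight2 \<phi> \<omega> x)"
    by (simp add: transport_def weight2_def norm_mult power_mult_distrib mult_ac)
  also have "integrable lborel (\<lambda>x. (cmod (borel_version f x))\<^sup>2 * weight2 \<phi> \<omega> x)
      \<longleftrightarrow> integrable lebesgue (\<lambda>x. (cmod (f x))\<^sup>2 * weight2 \<phi> \<omega> x)"
  proof (rule lebesgue_integral_AE_borel(1)[symmetric])
    show "(\<lambda>x. (cmod (f x))\<^sup>2 * weight2 \<phi> \<omega> x) \<in> borel_measurable lebesgue"
      using f borel_imp_lebesgue_measurable[OF measurable_weight2] by measurable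
    show "AE x in lborel. (cmod (f x))\<^sup>2 * weight2 \<phi> \<omega> x = (cmod (borel_version f x))\<^sup>2 * weight2 \<phi> \<omega> x"
      using borel_version(2)[OF f] by eventually_elim simp
  qed measurable
  finally show ?thesis
    using f by (simp add: wL2_def)
qed

definition unitary_fourier :: "(real ^ 'n \<Rightarrow> complex) \<Rightarrow> real ^ 'n \<Rightarrow> complex" where
  "unitary_fourier f = plancherel (transport (borel_version f))"

lemma L2_measurable: "f \<in> L2_\<phi>\<omega> \<phi> \<omega> \<Longrightarrow> f \<in> borel_measurable lebesgue"
  by (simp add: wL2_def)

lemma transport_L2sp: "f \<in> L2_\<phi>\<omega> \<phi> \<omega> \<Longrightarrow> transport (borel_version f) \<in> L2sp lborel"
  using transport_L2sp_iff L2_measurable by blast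

lemma unitary_fourier_L2sp: "f \<in> L2_\<phi>\<omega> \<phi> \<omega> \<Longrightarrow> unitary_fourier f \<in> L2sp lborel"
  unfolding unitary_fourier_def by (intro plancherel_spec(1) transport_L2sp)

lemma L2sp_imp_wL2:
  assumes h: "h \<in> L2sp lborel"
  shows "h \<in> wL2 (\<lambda>_. 1)"
proof -
  have [measurable]: "h \<in> borel_measurable borel"
    using h by (simp add: L2sp_def)
  have "(\<lambda>x. (cmod (h x))\<^sup>2) \<in> borel_measurable lborel"
    by measurable
  then show ?thesis
    using h by (auto simp: wL2_def L2sp_iff_integrable integrable_completion measurable_completion)
qed

text \<open>Any Borel representative may replace the chosen one. Linearity relies on this, because
  \<open>borel_version\<close> of a combination need not be the combination of the versions.\<close>

lemma unitary_fourier_cong_AE: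
  assumes f: "f \<in> borel_measurable lebesgue" and g: "g \<in> borel_measurable borel"
    and ae: "AE x in lborel. f x = g x"
  shows "unitary_fourier f = plancherel (transport g)"
  unfolding unitary_fourier_def
proof (rule plancherel_cong_AE)
  note bv [measurable] = borel_version(1)[OF f] and g [measurable]
  show "transport (borel_version f) \<in> borel_measurable borel" "transport g \<in> borel_measurable borel"
    by measurable
  have "AE x in lborel. borel_version f x = g x"
    using borel_version(2)[OF f] ae by eventually_elim simp
  then show "AE y in lborel. transport (borel_version f) y = transport g y"
    by (intro transport_cong_AE) auto
qed

text \<open>The weight of \<open>L1_\<phi>\<omega>\<close> is the one that the substitution turns
  into integrability of the transported function. There \<open>plancherel\<close> agrees with
  \<open>ft\<close>, and substituting back gives the weighted integral.\<close>

lemma unitary_fourier_eq_weighted_fourier: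
  assumes f1: "f \<in> L1_\<phi>\<omega> \<phi> \<omega>" and f2: "f \<in> L2_\<phi>\<omega> \<phi> \<omega>"
  shows "AE \<xi> in lebesgue. unitary_fourier f \<xi> = weighted_fourier \<phi> \<omega> f \<xi>"
proof -
  have f [measurable]: "f \<in> borel_measurable lebesgue" using f2 by (rule L2_measurable)
  note bv [measurable] = borel_version(1)[OF f]
  note leb [measurable] = borel_imp_lebesgue_measurable[OF measurable_omega]
    borel_imp_lebesgue_measurable[OF measurable_jacobian] borel_imp_lebesgue_measurable[OF measurable_phi]
  have "integrable lebesgue (\<lambda>x. cmod (f x) * (cmod (\<omega> x) * J x))"
    using f1 by (simp add: L1_\<phi>\<omega>_def wL1_def)
  also have "integrable lebesgue (\<lambda>x. cmod (f x) * (cmod (\<omega> x) * J x))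
      \<longleftrightarrow> integrable lborel (\<lambda>x. cmod (borel_version f x) * (cmod (\<omega> x) * J x))"
  proof (rule lebesgue_integral_AE_borel(1))
    show "AE x in lborel. cmod (f x) * (cmod (\<omega> x) * J x) = cmod (borel_version f x) * (cmod (\<omega> x) * J x)"
      using borel_version(2)[OF f] by eventually_elim simp
  qed measurable
  finally have "integrable lborel (\<lambda>x. J x *\<^sub>R transport (borel_version f) (\<phi> x))"
    by (rule Bochner_Integration.integrable_bound) (auto simp: transport_def norm_mult mult_ac)
  then have int: "integrable lborel (transport (borel_version f))"
    by (subst integral_phi(1)) auto
  have "ft (transport (borel_version f)) \<xi> = weighted_fourier \<phi> \<omega> f \<xi>" for \<xi>
  proof -
    have "(\<integral>y. exp (- \<i> * complex_of_real (\<xi> \<bullet> y)) * transport (borel_version f) y \<partial>lborel)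
        = (\<integral>x. J x *\<^sub>R (exp (- \<i> * complex_of_real (\<xi> \<bullet> \<phi> x)) * transport (borel_version f) (\<phi> x)) \<partial>lborel)"
      by (rule integral_phi(2)) measurable
    also have "\<dots> = (\<integral>x. exp (- \<i> * complex_of_real (\<xi> \<bullet> \<phi> x)) * \<omega> x * borel_version f x
        * complex_of_real (J x) \<partial>lborel)"
      by (simp add: transport_def scaleR_conv_of_real mult_ac)
    also have "\<dots> = (\<integral>x. exp (- \<i> * complex_of_real (\<xi> \<bullet> \<phi> x)) * \<omega> x * f x * complex_of_real (J x) \<partial>lebesgue)"
    proof (rule lebesgue_integral_AE_borel(2)[symmetric])
      show "AE x in lborel. exp (- \<i> * complex_of_real (\<xi> \<bullet> \<phi> x)) * \<omega> x * f x * complex_of_real (J x)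
          = exp (- \<i> * complex_of_real (\<xi> \<bullet> \<phi> x)) * \<omega> x * borel_version f x * complex_of_real (J x)"
        using borel_version(2)[OF f] by eventually_elim simp
    qed measurable
    finally show ?thesis
      by (simp only: ft_def weighted_fourier_def ft_const_def) simp
  qed
  then have "AE \<xi> in lborel. unitary_fourier f \<xi> = weighted_fourier \<phi> \<omega> f \<xi>"
    using plancherel_eq_ft[OF transport_L2sp[OF f2] int] by (simp add: unitary_fourier_def)
  then show ?thesis
    by (rule AE_completion)
qed

lemma unitary_fourier_inner:
  assumes f2: "f \<in> L2_\<phi>\<omega> \<phi> \<omega>" and g2: "g \<in> L2_\<phi>\<omega> \<phi> \<omega>"
  shows "wL2_inner (\<lambda>_. 1) (unitary_fourier f) (unitary_fourier g) = wL2_inner (weight2 \<phi> \<omega>) f g"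
proof -
  note f [measurable] = L2_measurable[OF f2] and g [measurable] = L2_measurable[OF g2]
  note bv [measurable] = borel_version(1)[OF f] borel_version(1)[OF g]
  note leb [measurable] = borel_imp_lebesgue_measurable[OF measurable_weight2]
  have [measurable]: "unitary_fourier f \<in> borel_measurable borel" "unitary_fourier g \<in> borel_measurable borel"
    using unitary_fourier_L2sp[OF f2] unitary_fourier_L2sp[OF g2] by (auto simp: L2sp_def)
  have "wL2_inner (\<lambda>_. 1) (unitary_fourier f) (unitary_fourier g)
      = (\<integral>\<xi>. unitary_fourier f \<xi> * cnj (unitary_fourier g \<xi>) \<partial>lborel)"
    by (simp add: wL2_inner_def integral_completion)
  also have "\<dots> = (\<integral>y. transport (borel_version f) y * cnj (transport (borel_version g) y) \<partial>lborel)"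
    unfolding unitary_fourier_def by (intro plancherel_inner transport_L2sp f2 g2)
  also have "\<dots> = (\<integral>x. J x *\<^sub>R (transport (borel_version f) (\<phi> x) * cnj (transport (borel_version g) (\<phi> x))) \<partial>lborel)"
    by (rule integral_phi(2)) measurable
  also have "\<dots> = (\<integral>x. borel_version f x * cnj (borel_version g x) * complex_of_real (weight2 \<phi> \<omega> x) \<partial>lborel)"
    by (intro Bochner_Integration.integral_cong refl)
       (simp only: weight2_def of_real_mult complex_norm_square transport_def inv_simps complex_cnj_mult
          scaleR_conv_of_real mult_ac)
  also have "\<dots> = wL2_inner (weight2 \<phi> \<omega>) f g"
    unfolding wL2_inner_def
  proof (rule lebesgue_integral_AE_borel(2)[symmetric])
    show "AE x in lborel. f x * cnj (g x) * complex_of_real (weight2 \<phi> \<omega> x)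
        = borel_version f x * cnj (borel_version g x) * complex_of_real (weight2 \<phi> \<omega> x)"
      using borel_version(2)[OF f] borel_version(2)[OF g] by eventually_elim simp
  qed measurable
  finally show ?thesis .
qed

lemma unitary_fourier_linear:
  assumes f2: "f \<in> L2_\<phi>\<omega> \<phi> \<omega>" and g2: "g \<in> L2_\<phi>\<omega> \<phi> \<omega>"
  shows "AE \<xi> in lebesgue. unitary_fourier (\<lambda>x. a * f x + b * g x) \<xi>
    = a * unitary_fourier f \<xi> + b * unitary_fourier g \<xi>"
proof -
  note f [measurable] = L2_measurable[OF f2] and g [measurable] = L2_measurable[OF g2]
  note bv [measurable] = borel_version(1)[OF f] borel_version(1)[OF g]
  have "unitary_fourier (\<lambda>x. a * f x + b * g x)
      = plancherel (transport (\<lambda>x. a * borel_version f x + b * borel_version g x))"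
  proof (rule unitary_fourier_cong_AE)
    show "AE x in lborel. a * f x + b * g x = a * borel_version f x + b * borel_version g x"
      using borel_version(2)[OF f] borel_version(2)[OF g] by eventually_elim simp
  qed measurable
  also have "transport (\<lambda>x. a * borel_version f x + b * borel_version g x)
      = (\<lambda>y. a * transport (borel_version f) y + b * transport (borel_version g) y)"
    by (simp add: transport_def fun_eq_iff algebra_simps)
  finally have "AE \<xi> in lborel. unitary_fourier (\<lambda>x. a * f x + b * g x) \<xi>
      = a * unitary_fourier f \<xi> + b * unitary_fourier g \<xi>"
    unfolding unitary_fourier_def
    using plancherel_linear[OF transport_L2sp[OF f2] transport_L2sp[OF g2]] by simp
  then show ?thesis
    by (rule AE_completion)
qed

lemma unitary_fourier_surj:
  assumes "h \<in> wL2 (\<lambda>_. 1)"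
  shows "\<exists>f \<in> L2_\<phi>\<omega> \<phi> \<omega>. AE \<xi> in lebesgue. unitary_fourier f \<xi> = h \<xi>"
proof -
  have h [measurable]: "h \<in> borel_measurable lebesgue" and hi: "integrable lebesgue (\<lambda>x. (cmod (h x))\<^sup>2)"
    using assms by (auto simp: wL2_def)
  note bv [measurable] = borel_version(1)[OF h]
  have "integrable lebesgue (\<lambda>x. (cmod (h x))\<^sup>2) \<longleftrightarrow> integrable lborel (\<lambda>x. (cmod (borel_version h x))\<^sup>2)"
  proof (rule lebesgue_integral_AE_borel(1))
    show "AE x in lborel. (cmod (h x))\<^sup>2 = (cmod (borel_version h x))\<^sup>2"
      using borel_version(2)[OF h] by eventually_elim simp
  qed measurable
  then have "borel_version h \<in> L2sp lborel"
    using hi by (simp add: L2sp_iff_integrable)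
  then obtain k where k: "k \<in> L2sp lborel" and pk: "AE \<xi> in lborel. plancherel k \<xi> = borel_version h \<xi>"
    using plancherel_surj by blast
  have [measurable]: "k \<in> borel_measurable borel" using k by (simp add: L2sp_def)
  \<comment> \<open>The inverse of \<open>transport\<close>, possible because \<omega> has no
    zeros.\<close>
  define f where "f x = k (\<phi> x) / \<omega> x" for x
  have [measurable]: "f \<in> borel_measurable borel"
    unfolding f_def by measurable
  then have fl: "f \<in> borel_measurable lebesgue"
    by (rule borel_imp_lebesgue_measurable)
  note bvf [measurable] = borel_version(1)[OF fl]
  have tf: "transport f = k"
    by (simp add: transport_def f_def omega_nonzero fun_eq_iff)
  have "AE y in lborel. transport (borel_version f) y = transport f y"
    using borel_version(2)[OF fl] by (intro transport_cong_AE) auto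
  then have "l2sq lborel (transport (borel_version f)) = l2sq lborel k"
    unfolding tf by (rule l2sq_cong_AE)
  then have "transport (borel_version f) \<in> L2sp lborel"
    using k by (simp add: L2sp_def)
  then have "f \<in> L2_\<phi>\<omega> \<phi> \<omega>"
    using transport_L2sp_iff[OF fl] by blast
  moreover have "unitary_fourier f = plancherel k"
    using unitary_fourier_cong_AE[OF fl, of f] by (simp add: tf)
  moreover have "AE \<xi> in lborel. plancherel k \<xi> = h \<xi>"
    using pk borel_version(2)[OF h] by eventually_elim simp
  ultimately show ?thesis
    by (auto intro!: bexI[of _ f] AE_completion)
qed

lemma unitary_wL2_unitary_fourier: "unitary_wL2 (weight2 \<phi> \<omega>) (\<lambda>_. 1) unitary_fourier"
  unfolding unitary_wL2_def
proof (intro conjI ballI allI impI)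
  fix f g assume f2: "f \<in> L2_\<phi>\<omega> \<phi> \<omega>" and g2: "g \<in> L2_\<phi>\<omega> \<phi> \<omega>" and ae: "AE x in lebesgue. f x = g x"
  note f = L2_measurable[OF f2] and g = L2_measurable[OF g2]
  have "AE x in lborel. f x = g x"
    using ae by (simp add: AE_completion_iff)
  then have "AE x in lborel. f x = borel_version g x"
    using borel_version(2)[OF g] by eventually_elim simp
  from unitary_fourier_cong_AE[OF f borel_version(1)[OF g] this]
  show "AE y in lebesgue. unitary_fourier f y = unitary_fourier g y"
    by (simp add: unitary_fourier_def)
qed (auto intro: L2sp_imp_wL2 unitary_fourier_L2sp unitary_fourier_linear unitary_fourier_inner unitary_fourier_surj)

lemma wL2_inner_self:
  fixes f :: "real ^ 'n \<Rightarrow> complex"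
  shows "wL2_inner w f f = complex_of_real (LINT x|lebesgue. (cmod (f x))\<^sup>2 * w x)"
  unfolding wL2_inner_def
  by (simp only: complex_norm_square[symmetric] of_real_mult[symmetric] integral_complex_of_real)

lemma unitary_fourier_norm:
  assumes "f \<in> L2_\<phi>\<omega> \<phi> \<omega>"
  shows "(LINT x|lebesgue. (cmod (f x))\<^sup>2 * weight2 \<phi> \<omega> x) = (LINT \<xi>|lebesgue. (cmod (unitary_fourier f \<xi>))\<^sup>2)"
  using unitary_fourier_inner[OF assms assms] unfolding wL2_inner_self of_real_eq_iff by simp

end

theorem theorem3p5:
  fixes \<phi> :: "real ^ 'n \<Rightarrow> real ^ 'n"
    and \<omega> :: "real ^ 'n \<Rightarrow> complex"
  assumes "smooth_diffeo \<phi>"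
    and "\<forall>x. \<bar>jacobian_det \<phi> x\<bar> \<noteq> 0"
    and "smooth_map \<omega>"
    and "\<forall>x. \<omega> x \<noteq> 0"
  shows "\<exists>F :: (real ^ 'n \<Rightarrow> complex) \<Rightarrow> (real ^ 'n \<Rightarrow> complex).
    (\<forall>f \<in> L1_\<phi>\<omega> \<phi> \<omega> \<inter> L2_\<phi>\<omega> \<phi> \<omega>. AE \<xi> in lebesgue. F f \<xi> = weighted_fourier \<phi> \<omega> f \<xi>) \<and>
    unitary_wL2 (weight2 \<phi> \<omega>) (\<lambda>_. 1) F \<and>
    (\<forall>f \<in> L2_\<phi>\<omega> \<phi> \<omega>. \<forall>g \<in> L2_\<phi>\<omega> \<phi> \<omega>.
       wL2_inner (weight2 \<phi> \<omega>) f g = wL2_inner (\<lambda>_. 1) (F f) (F g)) \<and>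
    (\<forall>f \<in> L2_\<phi>\<omega> \<phi> \<omega>.
       (wL2_norm (weight2 \<phi> \<omega>) f)\<^sup>2
         = (LINT x|lebesgue. (cmod (f x))\<^sup>2 * (cmod (\<omega> x))\<^sup>2 * \<bar>jacobian_det \<phi> x\<bar>) \<and>
       (LINT x|lebesgue. (cmod (f x))\<^sup>2 * (cmod (\<omega> x))\<^sup>2 * \<bar>jacobian_det \<phi> x\<bar>)
         = (LINT \<xi>|lebesgue. (cmod (F f \<xi>))\<^sup>2))"
proof -
  interpret weighted_diffeo \<phi> \<omega>
    using assms by unfold_locales auto
  have w: "(cmod (f x))\<^sup>2 * (cmod (\<omega> x))\<^sup>2 * \<bar>jacobian_det \<phi> x\<bar> = (cmod (f x))\<^sup>2 * weight2 \<phi> \<omega> x"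
    for f :: "real ^ 'n \<Rightarrow> complex" and x
    by (simp add: weight2_def mult.assoc)
  \<comment> \<open>\<open>wL2_norm\<close> is a square root, so squaring returns the integral
    itself only once its sign is known.\<close>
  have "(LINT x|lebesgue. (cmod (f x))\<^sup>2 * weight2 \<phi> \<omega> x) \<ge> 0" for f :: "real ^ 'n \<Rightarrow> complex"
    by (intro Bochner_Integration.integral_nonneg) (simp add: weight2_def)
  then have n: "(wL2_norm (weight2 \<phi> \<omega>) f)\<^sup>2 = (LINT x|lebesgue. (cmod (f x))\<^sup>2 * weight2 \<phi> \<omega> x)"
    for f :: "real ^ 'n \<Rightarrow> complex"
    by (simp add: wL2_norm_def)
  show ?thesis
    unfolding w
    by (intro exI[of _ unitary_fourier] conjI ballI)
       (auto simp: n unitary_fourier_norm unitary_fourier_inner unitary_wL2_unitary_fourier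
         unitary_fourier_eq_weighted_fourier)
qed

end
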